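(* Let $F$ be a finite-rank free group and let $R$ be a finite subset of $\{g,\ {}^Fg : g\in F\setminus\{1\}\}$. Then: (i) all the atomic $R$-allocating $F$-factorizations have the same number of factors; (ii) they all induce the same partition of $R$; (iii) for each $r\in R$, they all have the same $F$-conjugacy orbit of the factor to which $r$ is allocated, and if $r$ is an $F$-element, they all have the same factor to which $r$ is allocated; (iv) in each of them, all the factors with no elements of $R$ allocated to them are free subgroups of rank one.
   Context: For $f,g\in F$, ${}^fg:=fgf^{-1}$ and ${}^Fg:=\{{}^fg: f\in F\}$. An $F$-element is an element of $F$; an $F$-class is a conjugacy class ${}^Fg$ of an element of $F$. Thus $R$ is a finite set of nontrivial $F$-elements and nontrivial $F$-classes. An $F$-factorization is a multiset $\mathcal{H}$ of subgroups of $F$ such that the induced map $\ast_{H\in\mathcal{H}}H\to F$ is an isomorphism; the elements of $\mathcal{H}$ are called its factors. It is $R$-allocating if each factor is nontrivial and $R\subseteq\{h,{}^Fh : h\in H,\ H\in\mathcal{H}\}$; that is, each $F$-element $r\in R$ is an element of some $H\in\mathcal{H}$ and each $F$-class $r\in R$ contains an element of some $H\in\mathcal{H}$. In each case the factor $H$ is uniquely determined by $r$, and $r$ is said to be allocated to $H$. An $R$-allocating $F$-factorization $\mathcal{H}$ is atomic if no proper free-product refinement of $\ast_{H\in\mathcal{H}}H$ (obtained by further decomposing factors as nontrivial free products) is $R$-allocating. For $H\in\mathcal{H}$, $R_{|H,\mathcal{H}}$ denotes the set of elements of $R$ allocated to $H$; the partition of $R$ induced by $\mathcal{H}$ is $\{R_{|H,\mathcal{H}}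 : H\in\mathcal{H}\}\setminus\{\emptyset\}$. The $F$-conjugacy orbit of a subgroup $H$ is $\{fHf^{-1}: f\in F\}$. *)

theory Defs
  imports "HOL-Algebra.Algebra" "HOL-Library.Multiset"
begin

section \<open>Free products\<close>

text \<open>
  The free product of the groups \<open>G i\<close> with \<open>i \<in> I\<close> is built as the set of all words in
  letters \<open>(i, x)\<close> with \<open>x \<in> carrier (G i)\<close>, modulo multiplying adjacent letters from the same
  group and deleting letters that are the identity.
\<close>

definition fp_words :: "'i set \<Rightarrow> ('i \<Rightarrow> ('a, 'b) monoid_scheme) \<Rightarrow> ('i \<times> 'a) list set" where
  "fp_words I G = lists (SIGMA i:I. carrier (G i))"

inductive fp_eq :: "'i set \<Rightarrow> ('i \<Rightarrow> ('a, 'b) monoid_scheme) \<Rightarrow>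
    ('i \<times> 'a) list \<Rightarrow> ('i \<times> 'a) list \<Rightarrow> bool" for I G where
  refl: "w \<in> fp_words I G \<Longrightarrow> fp_eq I G w w"
| sym: "fp_eq I G v w \<Longrightarrow> fp_eq I G w v"
| trans: "fp_eq I G u v \<Longrightarrow> fp_eq I G v w \<Longrightarrow> fp_eq I G u w"
| merge: "u \<in> fp_words I G \<Longrightarrow> v \<in> fp_words I G \<Longrightarrow> i \<in> I \<Longrightarrow>
    x \<in> carrier (G i) \<Longrightarrow> y \<in> carrier (G i) \<Longrightarrow>
    fp_eq I G (u @ [(i, x), (i, y)] @ v) (u @ [(i, x \<otimes>\<^bsub>G i\<^esub> y)] @ v)"
| delete: "u \<in> fp_words I G \<Longrightarrow> v \<in> fp_words I G \<Longrightarrow> i \<in> I \<Longrightarrow>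
    fp_eq I G (u @ [(i, \<one>\<^bsub>G i\<^esub>)] @ v) (u @ v)"

definition fp_rel :: "'i set \<Rightarrow> ('i \<Rightarrow> ('a, 'b) monoid_scheme) \<Rightarrow>
    (('i \<times> 'a) list \<times> ('i \<times> 'a) list) set" where
  "fp_rel I G = {(v, w). fp_eq I G v w}"

definition free_product :: "'i set \<Rightarrow> ('i \<Rightarrow> ('a, 'b) monoid_scheme) \<Rightarrow>
    ('i \<times> 'a) list set monoid" where
  "free_product I G =
    \<lparr>carrier = fp_words I G // fp_rel I G,
     monoid.mult = (\<lambda>A B. fp_rel I G `` {u @ v | u v. u \<in> A \<and> v \<in> B}),
     one = fp_rel I G `` {[]}\<rparr>"

definition fp_inj :: "'i set \<Rightarrow> ('i \<Rightarrow> ('a, 'b) monoid_scheme) \<Rightarrow> 'i \<Rightarrow> 'a \<Rightarrow> ('i \<times> 'a) list set" where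
  "fp_inj I G i x = fp_rel I G `` {[(i, x)]}"

definition word_eval :: "('c, 'd) monoid_scheme \<Rightarrow> ('i \<Rightarrow> 'a \<Rightarrow> 'c) \<Rightarrow> ('i \<times> 'a) list \<Rightarrow> 'c" where
  "word_eval K \<phi> w = foldr (\<lambda>(i, x) z. \<phi> i x \<otimes>\<^bsub>K\<^esub> z) w \<one>\<^bsub>K\<^esub>"

text \<open>
  The map from the free product to \<open>K\<close> induced by homomorphisms \<open>\<phi> i\<close> from \<open>G i\<close> to \<open>K\<close>:
  all words in a class have the same value.
\<close>

definition fp_lift :: "('c, 'd) monoid_scheme \<Rightarrow> ('i \<Rightarrow> 'a \<Rightarrow> 'c) \<Rightarrow> ('i \<times> 'a) list set \<Rightarrow> 'c" where
  "fp_lift K \<phi> A = the_elem (word_eval K \<phi> ` A)"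

lemma fp_words_append [simp]:
  "u @ v \<in> fp_words I G \<longleftrightarrow> u \<in> fp_words I G \<and> v \<in> fp_words I G"
  by (auto simp: fp_words_def)

lemma fp_words_Nil [simp]: "[] \<in> fp_words I G"
  by (simp add: fp_words_def)

lemma fp_words_Cons [simp]:
  "(i, x) # w \<in> fp_words I G \<longleftrightarrow> i \<in> I \<and> x \<in> carrier (G i) \<and> w \<in> fp_words I G"
  by (auto simp: fp_words_def)

context
  fixes I :: "'i set" and G :: "'i \<Rightarrow> ('a, 'b) monoid_scheme"
  assumes grp: "\<And>i. i \<in> I \<Longrightarrow> group (G i)"
begin

lemma fp_eq_words: "fp_eq I G v w \<Longrightarrow> v \<in> fp_words I G \<and> w \<in> fp_words I G"
  by (induction rule: fp_eq.induct) (auto intro: monoid.m_closed group.is_monoid grp monoid.one_closed)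

lemma fp_eq_context:
  assumes "fp_eq I G v w" "a \<in> fp_words I G" "b \<in> fp_words I G"
  shows "fp_eq I G (a @ v @ b) (a @ w @ b)"
  using assms
proof (induction rule: fp_eq.induct)
  case (refl w) then show ?case by (simp add: fp_eq.refl)
next
  case (sym v w) then show ?case by (blast intro: fp_eq.sym)
next
  case (trans u v w) then show ?case by (blast intro: fp_eq.trans)
next
  case (merge u v i x y)
  then show ?case using fp_eq.merge[of "a @ u" I G "v @ b" i x y] by simp
next
  case (delete u v i)
  then show ?case using fp_eq.delete[of "a @ u" I G "v @ b" i] by simp
qed

lemma fp_eq_append:
  assumes "fp_eq I G u u'" "fp_eq I G v v'"
  shows "fp_eq I G (u @ v) (u' @ v')"
proof -
  have "fp_eq I G (u @ v) (u' @ v)"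
    using fp_eq_context[OF assms(1), of "[]" v] fp_eq_words[OF assms(2)] by simp
  moreover have "fp_eq I G (u' @ v) (u' @ v')"
    using fp_eq_context[OF assms(2), of "u'" "[]"] fp_eq_words[OF assms(1)] by simp
  ultimately show ?thesis by (rule fp_eq.trans)
qed

lemma fp_class_eq: "fp_eq I G v w \<Longrightarrow> fp_rel I G `` {v} = fp_rel I G `` {w}"
  by (auto simp: fp_rel_def intro: fp_eq.trans fp_eq.sym)

lemma free_product_carrierI: "w \<in> fp_words I G \<Longrightarrow> fp_rel I G `` {w} \<in> carrier (free_product I G)"
  by (auto simp: free_product_def intro: quotientI)

lemma free_product_carrierE:
  assumes "A \<in> carrier (free_product I G)"
  obtains w where "w \<in> fp_words I G" "A = fp_rel I G `` {w}"
  using assms by (auto simp: free_product_def elim: quotientE)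

lemma free_product_mult:
  assumes "u \<in> fp_words I G" "v \<in> fp_words I G"
  shows "fp_rel I G `` {u} \<otimes>\<^bsub>free_product I G\<^esub> fp_rel I G `` {v} = fp_rel I G `` {u @ v}"
proof -
  have "fp_eq I G (u @ v) z" if "fp_eq I G u u'" "fp_eq I G v v'" "fp_eq I G (u' @ v') z" for u' v' z
    using fp_eq_append[OF that(1,2)] that(3) by (rule fp_eq.trans)
  then show ?thesis
    using assms by (fastforce simp: free_product_def fp_rel_def intro: fp_eq.refl)
qed

lemma free_product_one: "\<one>\<^bsub>free_product I G\<^esub> = fp_rel I G `` {[]}"
  by (simp add: free_product_def)

lemma fp_inverse_word:
  "w \<in> fp_words I G \<Longrightarrow> \<exists>v \<in> fp_words I G. fp_eq I G (v @ w) []"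
proof (induction w)
  case Nil
  then show ?case by (intro bexI[of _ "[]"]) (auto intro: fp_eq.refl)
next
  case (Cons p w)
  obtain i x where p: "p = (i, x)" by force
  with Cons obtain v where v: "v \<in> fp_words I G" "fp_eq I G (v @ w) []" by auto
  from Cons.prems p have ix: "i \<in> I" "x \<in> carrier (G i)" "w \<in> fp_words I G" by auto
  interpret Gi: group "G i" using grp ix by auto
  have "fp_eq I G (v @ [(i, inv\<^bsub>G i\<^esub> x), (i, x)] @ w) (v @ [(i, inv\<^bsub>G i\<^esub> x \<otimes>\<^bsub>G i\<^esub> x)] @ w)"
    by (rule fp_eq.merge) (use v ix in auto)
  moreover have "fp_eq I G (v @ [(i, inv\<^bsub>G i\<^esub> x \<otimes>\<^bsub>G i\<^esub> x)] @ w) (v @ w)"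
    using fp_eq.delete[of v I G w i] v ix by simp
  ultimately have "fp_eq I G ((v @ [(i, inv\<^bsub>G i\<^esub> x)]) @ p # w) []"
    using v(2) p by (auto intro: fp_eq.trans)
  then show ?case using v ix by (intro bexI[of _ "v @ [(i, inv\<^bsub>G i\<^esub> x)]"]) auto
qed

lemma group_free_product: "group (free_product I G)"
proof (rule groupI)
  fix A assume "A \<in> carrier (free_product I G)"
  then obtain w where w: "w \<in> fp_words I G" "A = fp_rel I G `` {w}" by (rule free_product_carrierE)
  then obtain v where v: "v \<in> fp_words I G" "fp_eq I G (v @ w) []" using fp_inverse_word by blast
  show "\<exists>B\<in>carrier (free_product I G). B \<otimes>\<^bsub>free_product I G\<^esub> A = \<one>\<^bsub>free_product I G\<^esub>"
    using v w fp_class_eq[OF v(2)]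
    by (intro bexI[of _ "fp_rel I G `` {v}"])
      (auto simp: free_product_mult free_product_one intro: free_product_carrierI)
  show "\<one>\<^bsub>free_product I G\<^esub> \<otimes>\<^bsub>free_product I G\<^esub> A = A"
    using w by (simp add: free_product_one free_product_mult)
next
  show "\<one>\<^bsub>free_product I G\<^esub> \<in> carrier (free_product I G)"
    by (simp add: free_product_one free_product_carrierI)
next
  fix A B assume "A \<in> carrier (free_product I G)" "B \<in> carrier (free_product I G)"
  then obtain u v where uv: "u \<in> fp_words I G" "A = fp_rel I G `` {u}"
    "v \<in> fp_words I G" "B = fp_rel I G `` {v}"
    by (metis free_product_carrierE)
  show "A \<otimes>\<^bsub>free_product I G\<^esub> B \<in> carrier (free_product I G)"
    using uv by (simp add: free_product_mult free_product_carrierI)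
  fix C assume "C \<in> carrier (free_product I G)"
  then obtain w where "w \<in> fp_words I G" "C = fp_rel I G `` {w}" by (rule free_product_carrierE)
  with uv
  show "A \<otimes>\<^bsub>free_product I G\<^esub> B \<otimes>\<^bsub>free_product I G\<^esub> C =
      A \<otimes>\<^bsub>free_product I G\<^esub> (B \<otimes>\<^bsub>free_product I G\<^esub> C)"
    by (simp add: free_product_mult)
qed

lemma fp_inj_hom: "i \<in> I \<Longrightarrow> fp_inj I G i \<in> hom (G i) (free_product I G)"
  using fp_class_eq[OF fp_eq.merge[of "[]" I G "[]" i]]
  by (intro homI) (simp_all add: fp_inj_def free_product_mult free_product_carrierI)

context
  fixes K :: "('c, 'd) monoid_scheme" and \<phi> :: "'i \<Rightarrow> 'a \<Rightarrow> 'c"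
  assumes K: "group K" and \<phi>: "\<And>i. i \<in> I \<Longrightarrow> \<phi> i \<in> hom (G i) K"
begin

interpretation K: group K by (rule K)

lemma word_eval_closed: "w \<in> fp_words I G \<Longrightarrow> word_eval K \<phi> w \<in> carrier K"
  using \<phi> by (induction w) (auto simp: word_eval_def hom_def Pi_iff)

lemma word_eval_append:
  "u \<in> fp_words I G \<Longrightarrow> v \<in> fp_words I G \<Longrightarrow>
    word_eval K \<phi> (u @ v) = word_eval K \<phi> u \<otimes>\<^bsub>K\<^esub> word_eval K \<phi> v"
proof (induction u)
  case Nil
  then show ?case using word_eval_closed[of v] by (simp add: word_eval_def)
next
  case (Cons p u)
  obtain i x where p: "p = (i, x)" by force
  then have "\<phi> i x \<in> carrier K" using Cons.prems \<phi> by (auto simp: hom_def)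
  then show ?case
    using Cons word_eval_closed[of u] word_eval_closed[of v] p
    by (simp add: word_eval_def K.m_assoc)
qed

lemma word_eval_fp_eq: "fp_eq I G v w \<Longrightarrow> word_eval K \<phi> v = word_eval K \<phi> w"
proof (induction rule: fp_eq.induct)
  case (merge u v i x y)
  interpret Gi: group "G i" using grp merge by auto
  have h: "\<phi> i (x \<otimes>\<^bsub>G i\<^esub> y) = \<phi> i x \<otimes>\<^bsub>K\<^esub> \<phi> i y" "\<phi> i x \<in> carrier K" "\<phi> i y \<in> carrier K"
    using \<phi>[of i] merge by (auto simp: hom_def)
  have "word_eval K \<phi> [(i, x), (i, y)] = word_eval K \<phi> [(i, x \<otimes>\<^bsub>G i\<^esub> y)]"
    using h by (simp add: word_eval_def)
  then show ?case using merge
    by (simp add: word_eval_append del: append_Cons append_Nil)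
next
  case (delete u v i)
  interpret Gi: group "G i" using grp delete by auto
  have "\<phi> i \<one>\<^bsub>G i\<^esub> = \<one>\<^bsub>K\<^esub>"
    using \<phi>[of i] delete K Gi.is_group hom_one by blast
  then have "word_eval K \<phi> [(i, \<one>\<^bsub>G i\<^esub>)] = \<one>\<^bsub>K\<^esub>" by (simp add: word_eval_def)
  then show ?case using delete word_eval_closed
    by (simp add: word_eval_append del: append_Cons append_Nil)
qed auto

lemma fp_lift_class:
  assumes "w \<in> fp_words I G"
  shows "fp_lift K \<phi> (fp_rel I G `` {w}) = word_eval K \<phi> w"
proof -
  have "word_eval K \<phi> ` (fp_rel I G `` {w}) = {word_eval K \<phi> w}"
    using assms word_eval_fp_eq[of w] by (force simp: fp_rel_def intro: fp_eq.refl)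
  then show ?thesis by (simp add: fp_lift_def)
qed

lemma fp_lift_hom: "fp_lift K \<phi> \<in> hom (free_product I G) K"
proof (rule homI)
  fix A assume "A \<in> carrier (free_product I G)"
  then obtain u where u: "u \<in> fp_words I G" "A = fp_rel I G `` {u}" by (rule free_product_carrierE)
  then show "fp_lift K \<phi> A \<in> carrier K" by (simp add: fp_lift_class word_eval_closed)
  fix B assume "B \<in> carrier (free_product I G)"
  then obtain v where "v \<in> fp_words I G" "B = fp_rel I G `` {v}" by (rule free_product_carrierE)
  with u show "fp_lift K \<phi> (A \<otimes>\<^bsub>free_product I G\<^esub> B) = fp_lift K \<phi> A \<otimes>\<^bsub>K\<^esub> fp_lift K \<phi> B"
    by (simp add: fp_lift_class free_product_mult word_eval_append)
qed

lemma fp_lift_inj: "i \<in> I \<Longrightarrow> x \<in> carrier (G i) \<Longrightarrow> fp_lift K \<phi> (fp_inj I G i x) = \<phi> i x"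
  using \<phi>[of i] by (simp add: fp_inj_def fp_lift_class word_eval_def hom_def Pi_iff)

lemma fp_lift_unique:
  assumes \<psi>: "\<psi> \<in> hom (free_product I G) K"
    and ext: "\<And>i x. i \<in> I \<Longrightarrow> x \<in> carrier (G i) \<Longrightarrow> \<psi> (fp_inj I G i x) = \<phi> i x"
    and A: "A \<in> carrier (free_product I G)"
  shows "\<psi> A = fp_lift K \<phi> A"
proof -
  have "\<psi> (fp_rel I G `` {w}) = word_eval K \<phi> w" if "w \<in> fp_words I G" for w
    using that
  proof (induction w)
    case Nil
    then show ?case
      using hom_one[OF \<psi> group_free_product K] by (simp add: free_product_one word_eval_def)
  next
    case (Cons p w)
    obtain i x where p: "p = (i, x)" by force
    then have ix: "i \<in> I" "x \<in> carrier (G i)" "w \<in> fp_words I G" using Cons.prems by auto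
    have "fp_rel I G `` {p # w} = fp_inj I G i x \<otimes>\<^bsub>free_product I G\<^esub> fp_rel I G `` {w}"
      using ix p free_product_mult[of "[(i, x)]" w] by (simp add: fp_inj_def)
    moreover have "fp_inj I G i x \<in> carrier (free_product I G)"
      using ix by (simp add: fp_inj_def free_product_carrierI)
    ultimately have "\<psi> (fp_rel I G `` {p # w}) = \<phi> i x \<otimes>\<^bsub>K\<^esub> word_eval K \<phi> w"
      using Cons.IH ix \<psi> ext by (simp add: hom_mult free_product_carrierI)
    then show ?case by (simp add: p word_eval_def)
  qed
  then show ?thesis using A by (auto elim!: free_product_carrierE simp: fp_lift_class)
qed

end

end


section \<open>Free groups\<close>

text \<open>The letter \<open>(s, True)\<close> stands for \<open>s\<close>, and \<open>(s, False)\<close> stands for its inverse.\<close>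

definition reduced_words :: "'a set \<Rightarrow> ('a \<times> bool) list set" where
  "reduced_words S =
    {w \<in> lists (S \<times> UNIV). successively (\<lambda>(s, b) (t, c). \<not> (s = t \<and> b \<noteq> c)) w}"

definition free_basis :: "('a, 'b) monoid_scheme \<Rightarrow> 'a set \<Rightarrow> bool" where
  "free_basis F S \<longleftrightarrow> S \<subseteq> carrier F \<and>
    bij_betw (word_eval F (\<lambda>s b. if b then s else inv\<^bsub>F\<^esub> s)) (reduced_words S) (carrier F)"

definition free_group_of_rank :: "('a, 'b) monoid_scheme \<Rightarrow> nat \<Rightarrow> bool" where
  "free_group_of_rank F n \<longleftrightarrow>
    group F \<and> (\<exists>S. finite S \<and> card S = n \<and> free_basis F S)"


section \<open>Factorizations\<close>

datatype 'a mark = Element 'a | Class "'a set"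

definition conj_class :: "('a, 'b) monoid_scheme \<Rightarrow> 'a \<Rightarrow> 'a set" where
  "conj_class F g = {f \<otimes>\<^bsub>F\<^esub> g \<otimes>\<^bsub>F\<^esub> inv\<^bsub>F\<^esub> f | f. f \<in> carrier F}"

definition conj_orbit :: "('a, 'b) monoid_scheme \<Rightarrow> 'a set \<Rightarrow> 'a set set" where
  "conj_orbit F H = {f <#\<^bsub>F\<^esub> H #>\<^bsub>F\<^esub> inv\<^bsub>F\<^esub> f | f. f \<in> carrier F}"

definition marks :: "('a, 'b) monoid_scheme \<Rightarrow> 'a set \<Rightarrow> 'a mark set" where
  "marks F H = {Element h | h. h \<in> H} \<union> {Class (conj_class F h) | h. h \<in> H}"

text \<open>
  The index \<open>(H, k)\<close> stands for the \<open>k\<close>-th copy of \<open>H\<close> in the multiset, so that the free product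
  has one factor for each occurrence.
\<close>

definition factorization :: "('a, 'b) monoid_scheme \<Rightarrow> 'a set multiset \<Rightarrow> bool" where
  "factorization F \<H> \<longleftrightarrow> (\<forall>H \<in># \<H>. subgroup H F) \<and>
    fp_lift F (\<lambda>_ x. x) \<in>
      iso (free_product {(H, k). k < count \<H> H} (\<lambda>(H, k). F\<lparr>carrier := H\<rparr>)) F"

definition allocating :: "('a, 'b) monoid_scheme \<Rightarrow> 'a mark set \<Rightarrow> 'a set multiset \<Rightarrow> bool" where
  "allocating F R \<H> \<longleftrightarrow> factorization F \<H> \<and> (\<forall>H \<in># \<H>. H \<noteq> {\<one>\<^bsub>F\<^esub>}) \<and>
    R \<subseteq> (\<Union>H \<in> set_mset \<H>. marks F H)"

text \<open>
  A refinement replaces each occurrence of a factor \<open>H\<close> by the factors of some factorization of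
  \<open>H\<close> into nontrivial subgroups, possibly just \<open>H\<close> itself.
\<close>

definition refinement ::
    "('a, 'b) monoid_scheme \<Rightarrow> 'a set multiset \<Rightarrow> 'a set multiset \<Rightarrow> bool" where
  "refinement F \<H> \<K> \<longleftrightarrow>
    (\<exists>N. rel_mset (\<lambda>H D. factorization (F\<lparr>carrier := H\<rparr>) D \<and> (\<forall>K \<in># D. K \<noteq> {\<one>\<^bsub>F\<^esub>})) \<H> N \<and>
      \<K> = \<Sum>\<^sub># N)"

definition atomic :: "('a, 'b) monoid_scheme \<Rightarrow> 'a mark set \<Rightarrow> 'a set multiset \<Rightarrow> bool" where
  "atomic F R \<H> \<longleftrightarrow> allocating F R \<H> \<and>
    \<not> (\<exists>\<K>. refinement F \<H> \<K> \<and> \<K> \<noteq> \<H> \<and> allocating F R \<K>)"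

definition allocated :: "('a, 'b) monoid_scheme \<Rightarrow> 'a mark set \<Rightarrow> 'a set \<Rightarrow> 'a mark set" where
  "allocated F R H = R \<inter> marks F H"

definition induced_partition ::
    "('a, 'b) monoid_scheme \<Rightarrow> 'a mark set \<Rightarrow> 'a set multiset \<Rightarrow> 'a mark set set" where
  "induced_partition F R \<H> = allocated F R ` set_mset \<H> - {{}}"

end

theory Submission
  imports Defs
begin

text \<open>
  Suppose that \<open>\<H>\<close> is atomic and \<open>\<K>\<close> is allocating. By the Kurosh subgroup theorem, the free product
  decomposition \<open>\<K>\<close> of \<open>F\<close> decomposes each factor \<open>H\<close> of \<open>\<H>\<close> as the free product of intersections
  of \<open>H\<close> with conjugates of factors of \<open>\<K>\<close> and of infinite cyclic groups. Every mark allocated to \<open>H\<close>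
  is also allocated to a factor of \<open>\<K>\<close>, so it lives in one of these intersections; thus replacing \<open>H\<close>
  by its parts gives an allocating factorization again. Since \<open>\<H>\<close> is atomic, \<open>H\<close> has only one
  nontrivial part (\<open>atomic_indecomposable\<close>). If \<open>H\<close> has a mark \<open>r\<close>, this part is the intersection
  that contains \<open>r\<close>, so \<open>H\<close> is conjugate into the factor of \<open>\<K>\<close> to which \<open>r\<close> is allocated, and
  contained in it if \<open>r\<close> is an element (\<open>atomic_factor_conj_into\<close>).

  If both \<open>\<H>\<close> and \<open>\<K>\<close> are atomic, the factors that share a mark are therefore conjugate into each
  other. Since free factors are retracts, they are conjugate (\<open>conj_mutual\<close>), and since different
  factors of \<open>\<K>\<close> have no common nontrivial conjugate elements, factors that share one mark share
  all of them. This gives the claims on the partition and on the orbits. A factor without marks is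
  decomposed in the same way with respect to the cyclic factors generated by a basis of \<open>F\<close>, where
  each nontrivial part is infinite cyclic; hence it has rank one. For the number of factors it
  remains to count the unmarked ones: if there are \<open>m\<close> of them, then \<open>2 ^ m\<close> is the number of
  homomorphisms from \<open>F\<close> to a group of order two that vanish on all marked factors, and this
  depends only on the conjugacy orbits of the marked factors.

  The subgroup theorem is proved through universal properties alone, without trees or normal forms.
  A homomorphism from \<open>F\<close> to a wreath product over \<open>F / H\<close> can be prescribed on each factor, and its
  restriction to \<open>H\<close> yields the homomorphisms on \<open>H\<close> that the universal property of a free product
  demands (\<open>kurosh_extension\<close>). Coset representatives adapted to the factors
  (\<open>kurosh_system\<close>) determine the parts of \<open>H\<close>.
\<close>

section \<open>Internal free products\<close>

text \<open>A free product decomposition with an arbitrary index set, so that infinite families (the factors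
in the subgroup theorem) and families with repeated or trivial members are covered. Multisets of
factors are recovered at the end.\<close>

definition internal_free_product ::
    "('a, 'b) monoid_scheme \<Rightarrow> 'i set \<Rightarrow> ('i \<Rightarrow> 'a set) \<Rightarrow> bool" where
  "internal_free_product F I A \<longleftrightarrow> (\<forall>i\<in>I. subgroup (A i) F) \<and>
    fp_lift F (\<lambda>_ x. x) \<in> iso (free_product I (\<lambda>i. F\<lparr>carrier := A i\<rparr>)) F"

lemma hom_restrict_carrier:
  assumes "\<phi> \<in> hom F K" "H \<subseteq> carrier F"
  shows "\<phi> \<in> hom (F\<lparr>carrier := H\<rparr>) K"
  using assms by (auto simp: hom_def)

lemma hom_eq_on_generate:
  assumes F: "group F" and K: "group K" and "\<phi> \<in> hom F K" "\<psi> \<in> hom F K" "S \<subseteq> carrier F"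
    and eq: "\<And>x. x \<in> S \<Longrightarrow> \<phi> x = \<psi> x" and x: "x \<in> generate F S"
  shows "\<phi> x = \<psi> x"
proof -
  interpret p: group_hom F K \<phi> using assms by (simp add: group_hom_def group_hom_axioms_def)
  interpret q: group_hom F K \<psi> using assms by (simp add: group_hom_def group_hom_axioms_def)
  have "x \<in> carrier F \<and> \<phi> x = \<psi> x"
    using x by (induction) (use eq \<open>S \<subseteq> carrier F\<close> in auto)
  then show ?thesis by simp
qed

context group
begin

lemma internal_free_product_subgroup:
  "internal_free_product G I A \<Longrightarrow> i \<in> I \<Longrightarrow> subgroup (A i) G"
  by (simp add: internal_free_product_def)

lemma internal_free_product_groups:
  "internal_free_product G I A \<Longrightarrow> i \<in> I \<Longrightarrow> group (G\<lparr>carrier := A i\<rparr>)"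
  by (simp add: internal_free_product_def subgroup_imp_group)

lemma inclusion_hom: "H \<subseteq> carrier G \<Longrightarrow> (\<lambda>x. x) \<in> hom (G\<lparr>carrier := H\<rparr>) G"
  by (auto simp: hom_def)

text \<open>The universal property of the external free product, transported along the isomorphism. Apart from
generation, this is the only way in which a decomposition is used below.\<close>

lemma internal_free_product_extend:
  assumes fp: "internal_free_product G I A" and K: "group K"
    and \<phi>: "\<And>i. i \<in> I \<Longrightarrow> \<phi> i \<in> hom (G\<lparr>carrier := A i\<rparr>) K"
  obtains \<psi> where "\<psi> \<in> hom G K" "\<And>i x. i \<in> I \<Longrightarrow> x \<in> A i \<Longrightarrow> \<psi> x = \<phi> i x"
proof -
  let ?G = "\<lambda>i. G\<lparr>carrier := A i\<rparr>"
  let ?P = "free_product I ?G"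
  let ?e = "fp_lift G (\<lambda>_ x. x)"
  let ?j = "inv_into (carrier ?P) ?e"
  have grp: "\<And>i. i \<in> I \<Longrightarrow> group (?G i)" using fp by (rule internal_free_product_groups)
  have sub: "\<And>i. i \<in> I \<Longrightarrow> A i \<subseteq> carrier G"
    using fp by (auto dest: internal_free_product_subgroup subgroup.subset)
  have P: "group ?P" using grp by (rule group_free_product)
  have iso: "?e \<in> iso ?P G" using fp by (simp add: internal_free_product_def)
  have "?j \<in> hom G ?P" using group.iso_set_sym[OF P iso] by (simp add: iso_def)
  moreover have "fp_lift K \<phi> \<in> hom ?P K" using grp K \<phi> by (rule fp_lift_hom)
  ultimately have "fp_lift K \<phi> \<circ> ?j \<in> hom G K" by (rule Group.hom_compose)
  moreover have "(fp_lift K \<phi> \<circ> ?j) x = \<phi> i x" if "i \<in> I" "x \<in> A i" for i x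
  proof -
    have "?e (fp_inj I ?G i x) = x"
      by (rule fp_lift_inj[of I ?G G "\<lambda>_ x. x"]) (use that grp sub is_group inclusion_hom in auto)
    moreover have "fp_inj I ?G i x \<in> carrier ?P"
      using fp_inj_hom[of I ?G i] grp that by (auto simp: hom_def)
    moreover have "inj_on ?e (carrier ?P)" using iso by (auto simp: iso_def bij_betw_def)
    ultimately have "?j x = fp_inj I ?G i x"
      using inv_into_f_f[of ?e "carrier ?P" "fp_inj I ?G i x"] by simp
    moreover have "fp_lift K \<phi> (fp_inj I ?G i x) = \<phi> i x"
      by (rule fp_lift_inj) (use that grp K \<phi> in auto)
    ultimately show ?thesis by simp
  qed
  ultimately show ?thesis using that by blast
qed

lemma word_eval_in_generate:
  assumes "w \<in> fp_words I (\<lambda>i. G\<lparr>carrier := A i\<rparr>)"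
  shows "word_eval G (\<lambda>_ x. x) w \<in> generate G (\<Union>i\<in>I. A i)"
  using assms
proof (induction w)
  case Nil
  then show ?case by (simp add: word_eval_def generate.one)
next
  case (Cons p w)
  obtain i x where "p = (i, x)" by force
  then show ?case using Cons
    by (auto simp: word_eval_def intro!: generate.eng intro: generate.incl)
qed

lemma internal_free_product_eval:
  assumes "internal_free_product G I A" "x \<in> carrier G"
  obtains w where "w \<in> fp_words I (\<lambda>i. G\<lparr>carrier := A i\<rparr>)" "word_eval G (\<lambda>_ x. x) w = x"
proof -
  let ?G = "\<lambda>i. G\<lparr>carrier := A i\<rparr>"
  have grp: "\<And>i. i \<in> I \<Longrightarrow> group (?G i)" using assms(1) by (rule internal_free_product_groups)
  have sub: "\<And>i. i \<in> I \<Longrightarrow> A i \<subseteq> carrier G"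
    using assms(1) by (auto dest: internal_free_product_subgroup subgroup.subset)
  have "fp_lift G (\<lambda>_ x. x) ` carrier (free_product I ?G) = carrier G"
    using assms(1) by (auto simp: internal_free_product_def iso_def bij_betw_def)
  then obtain Z where "Z \<in> carrier (free_product I ?G)" "x = fp_lift G (\<lambda>_ x. x) Z"
    using assms(2) by blast
  then obtain w where w: "w \<in> fp_words I ?G" "x = fp_lift G (\<lambda>_ x. x) (fp_rel I ?G `` {w})"
    using grp by (metis free_product_carrierE)
  moreover have "fp_lift G (\<lambda>_ x. x) (fp_rel I ?G `` {w}) = word_eval G (\<lambda>_ x. x) w"
    by (rule fp_lift_class) (use w grp sub is_group inclusion_hom in auto)
  ultimately show ?thesis using that by metis
qed

lemma internal_free_product_generate:
  assumes "internal_free_product G I A"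
  shows "generate G (\<Union>i\<in>I. A i) = carrier G"
proof
  show "generate G (\<Union>i\<in>I. A i) \<subseteq> carrier G"
    by (rule generate_incl) (use assms in \<open>auto dest: internal_free_product_subgroup subgroup.subset\<close>)
  show "carrier G \<subseteq> generate G (\<Union>i\<in>I. A i)"
    by (metis assms internal_free_product_eval subsetI word_eval_in_generate)
qed

lemma internal_free_product_hom_eq:
  assumes fp: "internal_free_product G I A" and K: "group K" and "\<phi> \<in> hom G K" "\<psi> \<in> hom G K"
    and eq: "\<And>i x. i \<in> I \<Longrightarrow> x \<in> A i \<Longrightarrow> \<phi> x = \<psi> x" and x: "x \<in> carrier G"
  shows "\<phi> x = \<psi> x"
proof (rule hom_eq_on_generate[OF is_group K assms(3,4)])
  show "(\<Union>i\<in>I. A i) \<subseteq> carrier G"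
    using fp by (auto dest: internal_free_product_subgroup subgroup.subset)
  show "x \<in> generate G (\<Union>i\<in>I. A i)"
    using fp x by (simp add: internal_free_product_generate)
qed (use eq in auto)

text \<open>Converse of the universal property. It is enough to extend homomorphisms into one group, the
external free product itself: an extension of the canonical embeddings is inverse to the
evaluation map. In particular no normal form for words is needed to recognise a free product.\<close>

lemma internal_free_productI:
  assumes sub: "\<And>i. i \<in> I \<Longrightarrow> subgroup (A i) G"
    and gen: "carrier G \<subseteq> generate G (\<Union>i\<in>I. A i)"
    and ext: "\<And>\<phi>. (\<And>i. i \<in> I \<Longrightarrow> \<phi> i \<in> hom (G\<lparr>carrier := A i\<rparr>) (free_product I (\<lambda>i. G\<lparr>carrier := A i\<rparr>)))
      \<Longrightarrow> \<exists>\<psi>\<in>hom G (free_product I (\<lambda>i. G\<lparr>carrier := A i\<rparr>)). \<forall>i\<in>I. \<forall>x\<in>A i. \<psi> x = \<phi> i x"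
  shows "internal_free_product G I A"
proof -
  let ?G = "\<lambda>i. G\<lparr>carrier := A i\<rparr>"
  let ?P = "free_product I ?G"
  let ?e = "fp_lift G (\<lambda>_ x. x)"
  have grp: "\<And>i. i \<in> I \<Longrightarrow> group (?G i)" using sub by (simp add: subgroup_imp_group)
  have subs: "\<And>i. i \<in> I \<Longrightarrow> A i \<subseteq> carrier G" using sub by (rule subgroup.subset)
  have P: "group ?P" using grp by (rule group_free_product)
  have e: "?e \<in> hom ?P G"
    by (rule fp_lift_hom) (use grp subs is_group inclusion_hom in auto)
  have e_inj: "?e (fp_inj I ?G i x) = x" if "i \<in> I" "x \<in> A i" for i x
    by (rule fp_lift_inj[of I ?G G "\<lambda>_ x. x"]) (use that grp subs is_group inclusion_hom in auto)
  obtain \<psi> where \<psi>: "\<psi> \<in> hom G ?P" "\<And>i x. i \<in> I \<Longrightarrow> x \<in> A i \<Longrightarrow> \<psi> x = fp_inj I ?G i x"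
    using ext[of "fp_inj I ?G"] fp_inj_hom[of I ?G] grp by metis
  have "(\<psi> \<circ> ?e) Z = Z" if Z: "Z \<in> carrier ?P" for Z
  proof -
    have "\<psi> \<circ> ?e \<in> hom ?P ?P" using e \<psi>(1) by (rule Group.hom_compose)
    moreover have "(\<psi> \<circ> ?e) (fp_inj I ?G i x) = fp_inj I ?G i x" if "i \<in> I" "x \<in> carrier (?G i)" for i x
      using that \<psi> e_inj by simp
    ultimately have "(\<psi> \<circ> ?e) Z = fp_lift ?P (fp_inj I ?G) Z"
      using fp_lift_unique[of I ?G ?P "fp_inj I ?G" "\<psi> \<circ> ?e" Z] grp P fp_inj_hom[of I ?G] Z by blast
    moreover have "(\<lambda>Z. Z) Z = fp_lift ?P (fp_inj I ?G) Z"
      by (rule fp_lift_unique) (use grp P Z fp_inj_hom[of I ?G] in \<open>auto simp: hom_def\<close>)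
    ultimately show ?thesis by simp
  qed
  then have "inj_on ?e (carrier ?P)" by (intro inj_on_inverseI[of _ \<psi>]) auto
  moreover have "?e ` carrier ?P = carrier G"
  proof
    show "?e ` carrier ?P \<subseteq> carrier G" using e by (auto simp: hom_def)
    interpret e: group_hom ?P G ?e
      using e P by (simp add: group_hom_def group_hom_axioms_def)
    have "(\<Union>i\<in>I. A i) \<subseteq> ?e ` carrier ?P"
    proof clarify
      fix i x assume "i \<in> I" "x \<in> A i"
      then show "x \<in> ?e ` carrier ?P"
        using e_inj[of i x] fp_inj_hom[of I ?G i] grp by (force simp: hom_def image_iff Pi_iff)
    qed
    then have "generate G (\<Union>i\<in>I. A i) \<subseteq> ?e ` carrier ?P"
      by (rule generate_subgroup_incl) (rule e.img_is_subgroup)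
    then show "carrier G \<subseteq> ?e ` carrier ?P" using gen by blast
  qed
  ultimately show ?thesis
    using e sub by (simp add: internal_free_product_def iso_def bij_betw_def)
qed

lemma internal_free_product_retraction:
  assumes fp: "internal_free_product G I A" and i: "i \<in> I"
  obtains \<rho> where "\<rho> \<in> hom G G" "\<And>x. x \<in> A i \<Longrightarrow> \<rho> x = x"
    "\<And>k x. k \<in> I \<Longrightarrow> k \<noteq> i \<Longrightarrow> x \<in> A k \<Longrightarrow> \<rho> x = \<one>" "\<And>x. x \<in> carrier G \<Longrightarrow> \<rho> x \<in> A i"
proof -
  have sub: "subgroup (A i) G" using assms by (rule internal_free_product_subgroup)
  let ?K = "G\<lparr>carrier := A i\<rparr>"
  have K: "group ?K" using assms by (rule internal_free_product_groups)
  have "(if k = i then (\<lambda>x. x) else (\<lambda>_. \<one>)) \<in> hom (G\<lparr>carrier := A k\<rparr>) ?K" for k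
    using subgroup.one_closed[OF sub] by (auto simp: hom_def)
  then obtain \<rho> where \<rho>: "\<rho> \<in> hom G ?K"
    "\<And>k x. k \<in> I \<Longrightarrow> x \<in> A k \<Longrightarrow> \<rho> x = (if k = i then (\<lambda>x. x) else (\<lambda>_. \<one>)) x"
    using internal_free_product_extend[OF fp K, of "\<lambda>k. if k = i then (\<lambda>x. x) else (\<lambda>_. \<one>)"] by metis
  have "\<rho> \<in> hom G G" using \<rho>(1) subgroup.subset[OF sub] by (auto simp: hom_def)
  moreover have "\<rho> x \<in> A i" if "x \<in> carrier G" for x using \<rho>(1) that by (auto simp: hom_def)
  ultimately show ?thesis using \<rho>(2) i that by auto
qed

text \<open>The retraction onto one factor fixes \<open>x\<close> and kills every conjugate of the other factor.\<close>

lemma internal_free_product_conj_disjoint: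
  assumes fp: "internal_free_product G I A" and ik: "i \<in> I" "k \<in> I" "i \<noteq> k"
    and x: "x \<in> A i" and y: "y \<in> A k" and f: "f \<in> carrier G" and eq: "x = f \<otimes> y \<otimes> inv f"
  shows "x = \<one>"
proof -
  obtain \<rho> where \<rho>: "\<rho> \<in> hom G G" "\<And>x. x \<in> A i \<Longrightarrow> \<rho> x = x"
    "\<And>k x. k \<in> I \<Longrightarrow> k \<noteq> i \<Longrightarrow> x \<in> A k \<Longrightarrow> \<rho> x = \<one>"
    using internal_free_product_retraction[OF fp ik(1)] by metis
  interpret r: group_hom G G \<rho> using \<rho>(1) by (simp add: group_hom_def group_hom_axioms_def is_group)
  have "y \<in> carrier G" using fp ik(2) y by (meson internal_free_product_subgroup subgroup.mem_carrier)
  then have "\<rho> (f \<otimes> y \<otimes> inv f) = \<one>" using f \<rho>(3)[OF ik(2) _ y] ik(3) by (auto simp: r.hom_closed)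
  then show ?thesis using eq \<rho>(2)[OF x] by simp
qed

lemma internal_free_product_inter:
  assumes fp: "internal_free_product G I A" and "i \<in> I" "k \<in> I" "i \<noteq> k" "x \<in> A i" "x \<in> A k"
  shows "x = \<one>"
  using internal_free_product_conj_disjoint[OF assms, of \<one>] assms
  by (metis internal_free_product_subgroup subgroup.mem_carrier inv_one l_one one_closed r_one)

lemma internal_free_product_inj_on:
  assumes fp: "internal_free_product G I A" and nt: "\<And>i. i \<in> I \<Longrightarrow> A i \<noteq> {\<one>}"
  shows "inj_on A I"
proof (rule inj_onI, rule ccontr)
  fix i k assume h: "i \<in> I" "k \<in> I" "A i = A k" "i \<noteq> k"
  then have "A i \<subseteq> {\<one>}" using internal_free_product_inter[OF fp h(1,2,4)] by auto
  moreover have "\<one> \<in> A i" using fp h(1) by (meson internal_free_product_subgroup subgroup.one_closed)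
  ultimately show False using nt[OF h(1)] by auto
qed

lemma internal_free_product_reindex:
  assumes fp: "internal_free_product G I A" and f: "bij_betw f J I"
    and B: "\<And>j. j \<in> J \<Longrightarrow> B j = A (f j)"
  shows "internal_free_product G J B"
proof (rule internal_free_productI)
  fix j assume "j \<in> J"
  then show "subgroup (B j) G" using fp f B by (metis bij_betwE internal_free_product_subgroup)
next
  have "(\<Union>j\<in>J. B j) = (\<Union>i\<in>I. A i)" using f B by (auto simp: bij_betw_def)
  then show "carrier G \<subseteq> generate G (\<Union>j\<in>J. B j)"
    using internal_free_product_generate[OF fp] by simp
next
  let ?P = "free_product J (\<lambda>j. G\<lparr>carrier := B j\<rparr>)"
  fix \<phi> assume \<phi>: "\<And>j. j \<in> J \<Longrightarrow> \<phi> j \<in> hom (G\<lparr>carrier := B j\<rparr>) ?P"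
  have P: "group ?P"
    by (rule group_free_product) (use fp f B in \<open>metis bij_betwE internal_free_product_groups\<close>)
  let ?g = "inv_into J f"
  have g: "?g i \<in> J" "f (?g i) = i" if "i \<in> I" for i
    using that f by (auto simp: bij_betw_def inv_into_into f_inv_into_f)
  have "\<phi> (?g i) \<in> hom (G\<lparr>carrier := A i\<rparr>) ?P" if "i \<in> I" for i
    using \<phi>[OF g(1)[OF that]] g[OF that] B by simp
  then obtain \<psi> where "\<psi> \<in> hom G ?P" "\<And>i x. i \<in> I \<Longrightarrow> x \<in> A i \<Longrightarrow> \<psi> x = \<phi> (?g i) x"
    using internal_free_product_extend[OF fp P, of "\<lambda>i. \<phi> (?g i)"] by blast
  moreover have "f j \<in> I" "?g (f j) = j" if "j \<in> J" for j
    using that f by (auto simp: bij_betw_def)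
  ultimately show "\<exists>\<psi>\<in>hom G ?P. \<forall>j\<in>J. \<forall>x\<in>B j. \<psi> x = \<phi> j x" using B by metis
qed

lemma internal_free_product_image:
  assumes fp: "internal_free_product G I A" and nt: "\<And>i. i \<in> I \<Longrightarrow> A i \<noteq> {\<one>}"
  shows "internal_free_product G (A ` I) (\<lambda>H. H)"
proof (rule internal_free_product_reindex[OF fp])
  have "inj_on A I" using assms by (rule internal_free_product_inj_on)
  then show "bij_betw (inv_into I A) (A ` I) I"
    by (simp add: bij_betw_inv_into inj_on_imp_bij_betw)
qed (simp add: f_inv_into_f)

lemma generate_restrict:
  "subgroup H G \<Longrightarrow> S \<subseteq> H \<Longrightarrow> generate (G\<lparr>carrier := H\<rparr>) S = generate G S"
  by (simp add: generate_consistent)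

lemma internal_free_product_flatten:
  assumes fp: "internal_free_product G I A"
    and fps: "\<And>i. i \<in> I \<Longrightarrow> internal_free_product (G\<lparr>carrier := A i\<rparr>) (J i) (B i)"
  shows "internal_free_product G (SIGMA i:I. J i) (\<lambda>(i, j). B i j)"
proof (rule internal_free_productI)
  have sA: "subgroup (A i) G" if "i \<in> I" for i using fp that by (rule internal_free_product_subgroup)
  have sB': "subgroup (B i j) (G\<lparr>carrier := A i\<rparr>)" if "i \<in> I" "j \<in> J i" for i j
    using that group.internal_free_product_subgroup[OF subgroup_imp_group[OF sA] fps] by blast
  have sB: "subgroup (B i j) G" if "i \<in> I" "j \<in> J i" for i j
    using incl_subgroup[OF sA sB'] that by blast
  have BA: "B i j \<subseteq> A i" if "i \<in> I" "j \<in> J i" for i j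
    using subgroup.subset[OF sB'] that by simp
  have gB: "generate G (\<Union>j\<in>J i. B i j) = A i" if i: "i \<in> I" for i
  proof -
    have "generate (G\<lparr>carrier := A i\<rparr>) (\<Union>j\<in>J i. B i j) = A i"
      using group.internal_free_product_generate[OF subgroup_imp_group[OF sA[OF i]] fps[OF i]] by simp
    moreover have "(\<Union>j\<in>J i. B i j) \<subseteq> A i" using BA i by blast
    ultimately show ?thesis using generate_restrict sA i by metis
  qed
  show "subgroup (case x of (i, j) \<Rightarrow> B i j) G" if "x \<in> Sigma I J" for x
    using that sB by auto
  let ?U = "\<Union>x\<in>Sigma I J. case x of (i, j) \<Rightarrow> B i j"
  have Uc: "?U \<subseteq> carrier G" using sB by (auto dest: subgroup.subset)
  have "A i \<subseteq> generate G ?U" if i: "i \<in> I" for i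
    using mono_generate[of "\<Union>j\<in>J i. B i j" ?U] gB[OF i] i by fastforce
  then have "generate G (\<Union>i\<in>I. A i) \<subseteq> generate G ?U"
    using Uc by (intro generate_subgroup_incl generate_is_subgroup) auto
  then show "carrier G \<subseteq> generate G ?U" using internal_free_product_generate[OF fp] by simp
  let ?P = "free_product (Sigma I J) (\<lambda>x. G\<lparr>carrier := case x of (i, j) \<Rightarrow> B i j\<rparr>)"
  fix \<phi> assume \<phi>: "\<And>x. x \<in> Sigma I J \<Longrightarrow> \<phi> x \<in> hom (G\<lparr>carrier := case x of (i, j) \<Rightarrow> B i j\<rparr>) ?P"
  have P: "group ?P" by (rule group_free_product) (use sB in \<open>auto intro: subgroup_imp_group\<close>)
  have "\<exists>\<psi>. \<psi> \<in> hom (G\<lparr>carrier := A i\<rparr>) ?P \<and> (\<forall>j\<in>J i. \<forall>x\<in>B i j. \<psi> x = \<phi> (i, j) x)" if i: "i \<in> I" for i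
  proof -
    have "\<phi> (i, j) \<in> hom (G\<lparr>carrier := A i, carrier := B i j\<rparr>) ?P" if "j \<in> J i" for j
      using \<phi>[of "(i, j)"] i that by simp
    then show ?thesis
      using group.internal_free_product_extend[OF subgroup_imp_group[OF sA[OF i]] fps[OF i] P,
        of "\<lambda>j. \<phi> (i, j)"] by metis
  qed
  then obtain \<psi>' where \<psi>': "\<And>i. i \<in> I \<Longrightarrow> \<psi>' i \<in> hom (G\<lparr>carrier := A i\<rparr>) ?P"
    "\<And>i j x. i \<in> I \<Longrightarrow> j \<in> J i \<Longrightarrow> x \<in> B i j \<Longrightarrow> \<psi>' i x = \<phi> (i, j) x" by metis
  obtain \<psi> where "\<psi> \<in> hom G ?P" "\<And>i x. i \<in> I \<Longrightarrow> x \<in> A i \<Longrightarrow> \<psi> x = \<psi>' i x"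
    using internal_free_product_extend[OF fp P \<psi>'(1)] by blast
  then show "\<exists>\<psi>\<in>hom G ?P. \<forall>x\<in>Sigma I J. \<forall>y\<in>case x of (i, j) \<Rightarrow> B i j. \<psi> y = \<phi> x y"
    using \<psi>'(2) BA by (intro bexI[of _ \<psi>]) (auto simp: subset_iff)
qed

text \<open>Only a separation of one factor from the rest is needed: atomicity is refuted by two-factor
refinements.\<close>

lemma internal_free_product_split:
  assumes fp: "internal_free_product G I A" and i: "i \<in> I"
  shows "internal_free_product G UNIV
    (\<lambda>b. if b then A i else generate G (\<Union>k\<in>I - {i}. A k))" (is "internal_free_product G UNIV ?B")
proof (rule internal_free_productI)
  have sA: "subgroup (A k) G" if "k \<in> I" for k using fp that by (rule internal_free_product_subgroup)
  have sub: "A k \<subseteq> carrier G" if "k \<in> I" for k using sA[OF that] by (rule subgroup.subset)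
  then have Uc: "(\<Union>k\<in>I - {i}. A k) \<subseteq> carrier G" by blast
  show sB: "subgroup (?B b) G" for b
    using sA i Uc generate_is_subgroup by auto
  have incl: "A k \<subseteq> ?B (k = i)" if "k \<in> I" for k using that by (auto intro: generate.incl)
  have "(\<Union>k\<in>I. A k) \<subseteq> generate G (\<Union>b. ?B b)"
  proof clarify
    fix k x assume "k \<in> I" "x \<in> A k"
    then have "x \<in> ?B (k = i)" using incl by blast
    then show "x \<in> generate G (\<Union>b. ?B b)" by (intro generate.incl UN_I[of "k = i"]) simp_all
  qed
  moreover have "(\<Union>b. ?B b) \<subseteq> carrier G" using subgroup.subset[OF sB] by blast
  ultimately have "generate G (\<Union>k\<in>I. A k) \<subseteq> generate G (\<Union>b. ?B b)"
    by (intro generate_subgroup_incl generate_is_subgroup)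
  then show "carrier G \<subseteq> generate G (\<Union>b. ?B b)" using internal_free_product_generate[OF fp] by simp
  let ?P = "free_product UNIV (\<lambda>b. G\<lparr>carrier := ?B b\<rparr>)"
  fix \<phi> assume \<phi>: "\<And>b. b \<in> UNIV \<Longrightarrow> \<phi> b \<in> hom (G\<lparr>carrier := ?B b\<rparr>) ?P"
  have P: "group ?P" by (rule group_free_product) (use sB in \<open>blast intro: subgroup_imp_group\<close>)
  have "\<phi> (k = i) \<in> hom (G\<lparr>carrier := A k\<rparr>) ?P" if "k \<in> I" for k
    using hom_restrict_carrier[OF \<phi>[OF UNIV_I, of "k = i"], of "A k"] incl[OF that] by simp
  then obtain \<psi> where \<psi>: "\<psi> \<in> hom G ?P" "\<And>k x. k \<in> I \<Longrightarrow> x \<in> A k \<Longrightarrow> \<psi> x = \<phi> (k = i) x"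
    using internal_free_product_extend[OF fp P, of "\<lambda>k. \<phi> (k = i)"] by blast
  let ?S = "\<Union>k\<in>I - {i}. A k"
  have "\<psi> x = \<phi> False x" if x: "x \<in> ?B False" for x
  proof (rule hom_eq_on_generate[OF subgroup_imp_group[OF sB] P])
    show "\<psi> \<in> hom (G\<lparr>carrier := ?B False\<rparr>) ?P"
      using \<psi>(1) subgroup.subset[OF sB] by (rule hom_restrict_carrier)
    show "\<phi> False \<in> hom (G\<lparr>carrier := ?B False\<rparr>) ?P" using \<phi> by blast
    show "?S \<subseteq> carrier (G\<lparr>carrier := ?B False\<rparr>)" by (auto intro: generate.incl)
    have "generate (G\<lparr>carrier := ?B False\<rparr>) ?S = generate G ?S"
      by (rule generate_restrict[OF sB]) (auto intro: generate.incl)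
    then show "x \<in> generate (G\<lparr>carrier := ?B False\<rparr>) ?S" using x by simp
  qed (use \<psi>(2) in auto)
  then show "\<exists>\<psi>\<in>hom G ?P. \<forall>b\<in>UNIV. \<forall>x\<in>?B b. \<psi> x = \<phi> b x"
    using \<psi> i by (intro bexI[of _ \<psi>]) (auto split: if_splits)
qed

end

section \<open>Cocycles on cosets\<close>

text \<open>The product of \<open>G\<close> with the functions on \<open>G / H\<close>, written as functions on \<open>G\<close> that are invariant
under right translation by \<open>H\<close>, with the multiplication of a wreath product. A homomorphism
from \<open>G\<close> to this group over the identity of \<open>G\<close> is the same as a cocycle \<open>C\<close> with
\<open>C (g g') f = C g (g' f) C g' f\<close>, and restricting such a cocycle to \<open>H\<close> and to \<open>f = 1\<close> gives a
homomorphism from \<open>H\<close> to \<open>L\<close>.\<close>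

definition cocycle_group ::
    "('a, 'b) monoid_scheme \<Rightarrow> 'a set \<Rightarrow> ('c, 'd) monoid_scheme \<Rightarrow> ('a \<times> ('a \<Rightarrow> 'c)) monoid" where
  "cocycle_group G H L =
    \<lparr>carrier = carrier G \<times> {c \<in> carrier G \<rightarrow>\<^sub>E carrier L. \<forall>f\<in>carrier G. \<forall>h\<in>H. c (f \<otimes>\<^bsub>G\<^esub> h) = c f},
     monoid.mult = (\<lambda>(g, c) (g', c'). (g \<otimes>\<^bsub>G\<^esub> g', \<lambda>f\<in>carrier G. c (g' \<otimes>\<^bsub>G\<^esub> f) \<otimes>\<^bsub>L\<^esub> c' f)),
     one = (\<one>\<^bsub>G\<^esub>, \<lambda>f\<in>carrier G. \<one>\<^bsub>L\<^esub>)\<rparr>"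

context group
begin

lemma inv_mult_cancel [simp]:
  "x \<in> carrier G \<Longrightarrow> y \<in> carrier G \<Longrightarrow> inv x \<otimes> (x \<otimes> y) = y"
  "x \<in> carrier G \<Longrightarrow> y \<in> carrier G \<Longrightarrow> x \<otimes> (inv x \<otimes> y) = y"
  by (simp_all flip: m_assoc)

lemma group_cocycle_group:
  assumes L: "group L" and H: "H \<subseteq> carrier G"
  shows "group (cocycle_group G H L)"
proof (rule groupI)
  interpret L: group L by (rule L)
  fix x assume "x \<in> carrier (cocycle_group G H L)"
  then obtain g c where x: "x = (g, c)" and g: "g \<in> carrier G" and c: "c \<in> carrier G \<rightarrow>\<^sub>E carrier L"
    "\<And>f h. f \<in> carrier G \<Longrightarrow> h \<in> H \<Longrightarrow> c (f \<otimes> h) = c f"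
    by (auto simp: cocycle_group_def)
  have c_closed: "c f \<in> carrier L" if "f \<in> carrier G" for f using c(1) that by auto
  have hc: "h \<in> carrier G" if "h \<in> H" for h using that H by blast
  show "\<one>\<^bsub>cocycle_group G H L\<^esub> \<otimes>\<^bsub>cocycle_group G H L\<^esub> x = x"
    using g c_closed x c(1)
    by (auto simp: cocycle_group_def fun_eq_iff restrict_def PiE_def extensional_def)
  let ?y = "(inv g, \<lambda>f\<in>carrier G. inv\<^bsub>L\<^esub> (c (inv g \<otimes> f)))"
  have "?y \<in> carrier (cocycle_group G H L)"
    using g c_closed hc c(2) by (auto simp: cocycle_group_def simp flip: m_assoc)
  moreover have "?y \<otimes>\<^bsub>cocycle_group G H L\<^esub> x = \<one>\<^bsub>cocycle_group G H L\<^esub>"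
    using g c_closed x by (auto simp: cocycle_group_def fun_eq_iff restrict_def)
  ultimately show "\<exists>y\<in>carrier (cocycle_group G H L).
      y \<otimes>\<^bsub>cocycle_group G H L\<^esub> x = \<one>\<^bsub>cocycle_group G H L\<^esub>" by blast
  fix x' assume "x' \<in> carrier (cocycle_group G H L)"
  then obtain g' c' where x': "x' = (g', c')" and g': "g' \<in> carrier G" and c': "c' \<in> carrier G \<rightarrow>\<^sub>E carrier L"
    "\<And>f h. f \<in> carrier G \<Longrightarrow> h \<in> H \<Longrightarrow> c' (f \<otimes> h) = c' f"
    by (auto simp: cocycle_group_def)
  have c'_closed: "c' f \<in> carrier L" if "f \<in> carrier G" for f using c'(1) that by auto
  show "x \<otimes>\<^bsub>cocycle_group G H L\<^esub> x' \<in> carrier (cocycle_group G H L)"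
    using g c_closed g' c'_closed x x' hc c(2) c'(2)
    by (auto simp: cocycle_group_def simp flip: m_assoc)
  fix x'' assume "x'' \<in> carrier (cocycle_group G H L)"
  then obtain g'' c'' where x'': "x'' = (g'', c'')" and g'': "g'' \<in> carrier G"
    and c'': "c'' \<in> carrier G \<rightarrow>\<^sub>E carrier L"
    by (auto simp: cocycle_group_def)
  have c''_closed: "c'' f \<in> carrier L" if "f \<in> carrier G" for f using c'' that by auto
  show "x \<otimes>\<^bsub>cocycle_group G H L\<^esub> x' \<otimes>\<^bsub>cocycle_group G H L\<^esub> x'' =
      x \<otimes>\<^bsub>cocycle_group G H L\<^esub> (x' \<otimes>\<^bsub>cocycle_group G H L\<^esub> x'')"
    using x x' x'' g g' g'' c_closed c'_closed c''_closed
    by (auto simp: cocycle_group_def fun_eq_iff restrict_def m_assoc L.m_assoc)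
next
  interpret L: group L by (rule L)
  show "\<one>\<^bsub>cocycle_group G H L\<^esub> \<in> carrier (cocycle_group G H L)"
    using H by (auto simp: cocycle_group_def)
qed

text \<open>Cocycles can be prescribed independently on the factors, because a cocycle is a homomorphism to
\<open>cocycle_group\<close>. The first component of the extended homomorphism is the identity since it is
so on each factor.\<close>

lemma internal_free_product_cocycle:
  assumes fp: "internal_free_product G J K" and L: "group L" and H: "H \<subseteq> carrier G"
    and closed: "\<And>j k f. j \<in> J \<Longrightarrow> k \<in> K j \<Longrightarrow> f \<in> carrier G \<Longrightarrow> c j k f \<in> carrier L"
    and invariant: "\<And>j k f h. j \<in> J \<Longrightarrow> k \<in> K j \<Longrightarrow> f \<in> carrier G \<Longrightarrow> h \<in> H \<Longrightarrow> c j k (f \<otimes> h) = c j k f"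
    and cocycle: "\<And>j k k' f. j \<in> J \<Longrightarrow> k \<in> K j \<Longrightarrow> k' \<in> K j \<Longrightarrow> f \<in> carrier G \<Longrightarrow>
      c j (k \<otimes> k') f = c j k (k' \<otimes> f) \<otimes>\<^bsub>L\<^esub> c j k' f"
  obtains C where
    "\<And>g f. g \<in> carrier G \<Longrightarrow> f \<in> carrier G \<Longrightarrow> C g f \<in> carrier L"
    "\<And>g f h. g \<in> carrier G \<Longrightarrow> f \<in> carrier G \<Longrightarrow> h \<in> H \<Longrightarrow> C g (f \<otimes> h) = C g f"
    "\<And>g g' f. g \<in> carrier G \<Longrightarrow> g' \<in> carrier G \<Longrightarrow> f \<in> carrier G \<Longrightarrow>
      C (g \<otimes> g') f = C g (g' \<otimes> f) \<otimes>\<^bsub>L\<^esub> C g' f"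
    "\<And>j k f. j \<in> J \<Longrightarrow> k \<in> K j \<Longrightarrow> f \<in> carrier G \<Longrightarrow> C k f = c j k f"
proof -
  let ?W = "cocycle_group G H L"
  have W: "group ?W" using L H by (rule group_cocycle_group)
  have Kc: "k \<in> carrier G" if "j \<in> J" "k \<in> K j" for j k
    using internal_free_product_subgroup[OF fp that(1)] that(2) by (rule subgroup.mem_carrier)
  have "(\<lambda>k. (k, \<lambda>f\<in>carrier G. c j k f)) \<in> hom (G\<lparr>carrier := K j\<rparr>) ?W" if j: "j \<in> J" for j
  proof (rule homI)
    show "(k, \<lambda>f\<in>carrier G. c j k f) \<in> carrier ?W" if "k \<in> carrier (G\<lparr>carrier := K j\<rparr>)" for k
      using that j closed invariant Kc H by (auto simp: cocycle_group_def)
  qed (use j cocycle Kc in \<open>auto simp: cocycle_group_def fun_eq_iff restrict_def\<close>)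
  then obtain \<psi> where \<psi>: "\<psi> \<in> hom G ?W"
    "\<And>j k. j \<in> J \<Longrightarrow> k \<in> K j \<Longrightarrow> \<psi> k = (k, \<lambda>f\<in>carrier G. c j k f)"
    using internal_free_product_extend[OF fp W, of "\<lambda>j k. (k, \<lambda>f\<in>carrier G. c j k f)"] by blast
  have "fst \<in> hom ?W G" by (auto simp: hom_def cocycle_group_def)
  then have "fst \<circ> \<psi> \<in> hom G G" using \<psi>(1) Group.hom_compose by blast
  then have "(fst \<circ> \<psi>) g = (\<lambda>g. g) g" if "g \<in> carrier G" for g
    by (rule internal_free_product_hom_eq[OF fp is_group]) (use that \<psi>(2) in \<open>auto simp: hom_def\<close>)
  then have \<psi>_fst: "\<psi> g = (g, snd (\<psi> g))" if "g \<in> carrier G" for g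
    using that by (metis comp_apply prod.collapse)
  have mem: "(g, snd (\<psi> g)) \<in> carrier ?W" if "g \<in> carrier G" for g
    using \<psi>(1) \<psi>_fst that by (metis hom_in_carrier)
  show ?thesis
  proof (rule that[of "\<lambda>g. snd (\<psi> g)"])
    show "snd (\<psi> g) f \<in> carrier L" if "g \<in> carrier G" "f \<in> carrier G" for g f
      using mem that by (auto simp: cocycle_group_def)
    show "snd (\<psi> g) (f \<otimes> h) = snd (\<psi> g) f" if "g \<in> carrier G" "f \<in> carrier G" "h \<in> H" for g f h
      using mem that by (auto simp: cocycle_group_def)
    show "snd (\<psi> (g \<otimes> g')) f = snd (\<psi> g) (g' \<otimes> f) \<otimes>\<^bsub>L\<^esub> snd (\<psi> g') f"
      if "g \<in> carrier G" "g' \<in> carrier G" "f \<in> carrier G" for g g' f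
    proof -
      have "\<psi> (g \<otimes> g') = (g, snd (\<psi> g)) \<otimes>\<^bsub>?W\<^esub> (g', snd (\<psi> g'))"
        using \<psi>_fst \<psi>(1) that by (metis hom_mult)
      then show ?thesis using that by (simp add: cocycle_group_def)
    qed
    show "snd (\<psi> k) f = c j k f" if "j \<in> J" "k \<in> K j" "f \<in> carrier G" for j k f
      using \<psi>(2) that by simp
  qed
qed

end

section \<open>The Kurosh subgroup theorem\<close>

text \<open>Choices of coset representatives that witness the subgroup theorem for \<open>H\<close>. Consider the bipartite
graph whose vertices are the left cosets \<open>f H\<close> and the double cosets \<open>K j f H\<close>, with an edge \<open>(j, f H)\<close>
from \<open>f H\<close> to \<open>K j f H\<close>; this is the quotient by \<open>H\<close> of the Bass-Serre tree of the decomposition,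
and its fundamental group together with the vertex stabilisers describes \<open>H\<close>. Here \<open>rep f\<close>
represents the vertex \<open>f H\<close>, \<open>t j f\<close> the vertex \<open>K j f H\<close>, and \<open>s j f\<close> the edge; \<open>s j f\<close> lies in
the coset \<open>f H\<close> and in \<open>K j (t j f)\<close>. The representative of a double coset is that of one of its
cosets. An edge with \<open>s j f = rep f\<close> is regarded as a tree edge, and the condition \<open>tree\<close> says that
every coset other than \<open>H\<close> can be joined to \<open>H\<close> through tree edges, along which \<open>len\<close> decreases.\<close>

locale kurosh_system = group +
  fixes J :: "'j set" and K :: "'j \<Rightarrow> 'a set" and H :: "'a set"
    and rep :: "'a \<Rightarrow> 'a" and s :: "'j \<Rightarrow> 'a \<Rightarrow> 'a" and t :: "'j \<Rightarrow> 'a \<Rightarrow> 'a" and len :: "'a \<Rightarrow> nat"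
  assumes fp: "internal_free_product G J K" and H: "subgroup H G"
    and rep_mem: "f \<in> carrier G \<Longrightarrow> \<exists>h\<in>H. rep f = f \<otimes> h"
    and rep_right: "f \<in> carrier G \<Longrightarrow> h \<in> H \<Longrightarrow> rep (f \<otimes> h) = rep f"
    and rep_one: "rep \<one> = \<one>"
    and t_closed: "j \<in> J \<Longrightarrow> f \<in> carrier G \<Longrightarrow> t j f \<in> carrier G"
    and t_left: "j \<in> J \<Longrightarrow> f \<in> carrier G \<Longrightarrow> k \<in> K j \<Longrightarrow> t j (k \<otimes> f) = t j f"
    and t_right: "j \<in> J \<Longrightarrow> f \<in> carrier G \<Longrightarrow> h \<in> H \<Longrightarrow> t j (f \<otimes> h) = t j f"
    and rep_t: "j \<in> J \<Longrightarrow> f \<in> carrier G \<Longrightarrow> rep (t j f) = t j f"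
    and t_one: "j \<in> J \<Longrightarrow> t j \<one> = \<one>"
    and s_mem: "j \<in> J \<Longrightarrow> f \<in> carrier G \<Longrightarrow> \<exists>h\<in>H. s j f = f \<otimes> h"
    and s_right: "j \<in> J \<Longrightarrow> f \<in> carrier G \<Longrightarrow> h \<in> H \<Longrightarrow> s j (f \<otimes> h) = s j f"
    and s_orbit: "j \<in> J \<Longrightarrow> f \<in> carrier G \<Longrightarrow> \<exists>k\<in>K j. s j f = k \<otimes> t j f"
    and s_t: "j \<in> J \<Longrightarrow> f \<in> carrier G \<Longrightarrow> s j (t j f) = t j f"
    and tree: "f \<in> carrier G \<Longrightarrow> rep f \<noteq> \<one> \<Longrightarrow> \<exists>j\<in>J. s j f = rep f \<and> len (t j f) < len (rep f)"
begin

text \<open>The stabiliser in \<open>H\<close> of the vertex of the Bass-Serre tree represented by \<open>v\<close>, that is, the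
intersection of \<open>H\<close> with a conjugate of \<open>K j\<close>.\<close>

definition vertex_group :: "'j \<Rightarrow> 'a \<Rightarrow> 'a set" where
  "vertex_group j v = {a \<in> H. v \<otimes> a \<otimes> inv v \<in> K j}"

text \<open>The element of \<open>H\<close> by which the lifts of the edge \<open>(j, f H)\<close> at its two ends differ. It is trivial for
tree edges, and the others form a basis of a free factor of \<open>H\<close>.\<close>

definition edge_element :: "'j \<Rightarrow> 'a \<Rightarrow> 'a" where
  "edge_element j f = inv (rep f) \<otimes> s j f"

lemma K_subgroup: "j \<in> J \<Longrightarrow> subgroup (K j) G"
  using fp by (rule internal_free_product_subgroup)

lemma K_closed: "j \<in> J \<Longrightarrow> k \<in> K j \<Longrightarrow> k \<in> carrier G"
  using K_subgroup by (rule subgroup.mem_carrier)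

lemma H_closed: "h \<in> H \<Longrightarrow> h \<in> carrier G"
  using H by (rule subgroup.mem_carrier)

lemma s_closed: "j \<in> J \<Longrightarrow> f \<in> carrier G \<Longrightarrow> s j f \<in> carrier G"
  using s_mem H_closed by fastforce

lemma rep_closed: "f \<in> carrier G \<Longrightarrow> rep f \<in> carrier G"
  using rep_mem H_closed by fastforce

lemma t_orbit:
  assumes "j \<in> J" "f \<in> carrier G"
  obtains k h where "k \<in> K j" "h \<in> H" "f = k \<otimes> t j f \<otimes> h"
proof -
  obtain h where h: "h \<in> H" "s j f = f \<otimes> h" using s_mem assms by blast
  obtain k where k: "k \<in> K j" "s j f = k \<otimes> t j f" using s_orbit assms by blast
  have "f = s j f \<otimes> inv h" using h(1) assms H_closed by (simp add: h(2) m_assoc)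
  then have "f = k \<otimes> t j f \<otimes> inv h" by (simp flip: k(2))
  then show ?thesis using that k(1) subgroup.m_inv_closed[OF H h(1)] by metis
qed

lemma t_t:
  assumes "j \<in> J" "f \<in> carrier G" shows "t j (t j f) = t j f"
proof -
  obtain k h where kh: "k \<in> K j" "h \<in> H" "f = k \<otimes> t j f \<otimes> h" using t_orbit assms by metis
  have "t j (k \<otimes> t j f \<otimes> h) = t j (t j f)"
    using kh(1,2) assms K_closed t_closed by (simp add: t_left t_right)
  then show ?thesis by (simp flip: kh(3))
qed

lemma vertex_group_subgroup:
  assumes j: "j \<in> J" and v: "v \<in> carrier G"
  shows "subgroup (vertex_group j v) G"
proof (rule subgroupI)
  note K = K_subgroup[OF j]
  show "vertex_group j v \<subseteq> carrier G" using H_closed by (auto simp: vertex_group_def)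
  have "\<one> \<in> vertex_group j v"
    using v subgroup.one_closed[OF H] subgroup.one_closed[OF K] by (simp add: vertex_group_def)
  then show "vertex_group j v \<noteq> {}" by blast
  fix a assume a: "a \<in> vertex_group j v"
  then have a': "a \<in> H" "a \<in> carrier G" "v \<otimes> a \<otimes> inv v \<in> K j" using H_closed by (auto simp: vertex_group_def)
  have "inv (v \<otimes> a \<otimes> inv v) = v \<otimes> inv a \<otimes> inv v"
    using a' v by (simp add: inv_mult_group m_assoc)
  then show "inv a \<in> vertex_group j v"
    using subgroup.m_inv_closed[OF H a'(1)] subgroup.m_inv_closed[OF K a'(3)] by (simp add: vertex_group_def)
  fix b assume "b \<in> vertex_group j v"
  then have b': "b \<in> H" "b \<in> carrier G" "v \<otimes> b \<otimes> inv v \<in> K j" using H_closed by (auto simp: vertex_group_def)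
  have "(v \<otimes> a \<otimes> inv v) \<otimes> (v \<otimes> b \<otimes> inv v) = v \<otimes> (a \<otimes> b) \<otimes> inv v"
    using a' b' v by (simp add: m_assoc)
  then show "a \<otimes> b \<in> vertex_group j v"
    using subgroup.m_closed[OF H a'(1) b'(1)] subgroup.m_closed[OF K a'(3) b'(3)] by (simp add: vertex_group_def)
qed

lemma edge_element_mem:
  assumes "j \<in> J" "f \<in> carrier G" shows "edge_element j f \<in> H"
proof -
  obtain h h' where h: "h \<in> H" "s j f = f \<otimes> h" "h' \<in> H" "rep f = f \<otimes> h'"
    using s_mem rep_mem assms by blast
  then have "edge_element j f = inv h' \<otimes> h"
    using assms H_closed by (simp add: edge_element_def inv_mult_group m_assoc)
  then show ?thesis using h H by (simp add: subgroup.m_closed subgroup.m_inv_closed)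
qed

lemma edge_element_right: "j \<in> J \<Longrightarrow> f \<in> carrier G \<Longrightarrow> h \<in> H \<Longrightarrow> edge_element j (f \<otimes> h) = edge_element j f"
  by (simp add: edge_element_def rep_right s_right)

text \<open>Moving by \<open>k\<close> from \<open>f H\<close> to \<open>k f H\<close> stays within one double coset, so that, measured between the edge
representatives, it is an element of the vertex group of that double coset.\<close>

lemma vertex_step:
  assumes j: "j \<in> J" and f: "f \<in> carrier G" and k: "k \<in> K j"
  shows "inv (s j (k \<otimes> f)) \<otimes> k \<otimes> s j f \<in> vertex_group j (t j f)"
proof -
  note K = K_subgroup[OF j] and kc = K_closed[OF j]
  have kf: "k \<otimes> f \<in> carrier G" using kc k f by simp
  obtain h h' where h: "h \<in> H" "s j f = f \<otimes> h" "h' \<in> H" "s j (k \<otimes> f) = k \<otimes> f \<otimes> h'"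
    using s_mem j f kf by metis
  obtain k1 k2 where k12: "k1 \<in> K j" "s j f = k1 \<otimes> t j f" "k2 \<in> K j" "s j (k \<otimes> f) = k2 \<otimes> t j f"
    using s_orbit j f kf k t_left by metis
  have t: "t j f \<in> carrier G" using t_closed j f by blast
  have "inv (s j (k \<otimes> f)) \<otimes> k \<otimes> s j f = inv h' \<otimes> h"
    using h f kc[OF k] H_closed by (simp add: inv_mult_group m_assoc)
  moreover have "t j f \<otimes> (inv (s j (k \<otimes> f)) \<otimes> k \<otimes> s j f) \<otimes> inv (t j f) = inv k2 \<otimes> k \<otimes> k1"
    using k12 k t kc by (simp add: inv_mult_group m_assoc)
  ultimately show ?thesis using h H K k k12
    by (simp add: vertex_group_def subgroup.m_closed subgroup.m_inv_closed)
qed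

text \<open>Universal property of \<open>H\<close>: homomorphisms on the vertex groups and values \<open>u\<close> on the edges, trivial
on tree edges, extend to \<open>H\<close>. The data define a cocycle on each \<open>K j\<close>, where a step from \<open>f H\<close> to
\<open>k f H\<close> passes along the edge of \<open>f H\<close>, through the double coset, and back along the edge of \<open>k f H\<close>.
These extend to a cocycle \<open>C\<close> on the whole group, and \<open>h \<mapsto> C h 1\<close> is the required homomorphism. It
has the required values because \<open>C\<close> is trivial along the paths that join \<open>H\<close> to the
representatives, by induction along the tree.\<close>

lemma kurosh_extension:
  assumes L: "group L"
    and \<phi>: "\<And>j f. j \<in> J \<Longrightarrow> f \<in> carrier G \<Longrightarrow>
      \<phi> j (t j f) \<in> hom (G\<lparr>carrier := vertex_group j (t j f)\<rparr>) L"
    and u_closed: "\<And>j f. j \<in> J \<Longrightarrow> f \<in> carrier G \<Longrightarrow> u j f \<in> carrier L"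
    and u_right: "\<And>j f h. j \<in> J \<Longrightarrow> f \<in> carrier G \<Longrightarrow> h \<in> H \<Longrightarrow> u j (f \<otimes> h) = u j f"
    and u_tree: "\<And>j f. j \<in> J \<Longrightarrow> f \<in> carrier G \<Longrightarrow> s j f = rep f \<Longrightarrow> u j f = \<one>\<^bsub>L\<^esub>"
  obtains \<psi> where "\<psi> \<in> hom (G\<lparr>carrier := H\<rparr>) L"
    "\<And>j f a. j \<in> J \<Longrightarrow> f \<in> carrier G \<Longrightarrow> a \<in> vertex_group j (t j f) \<Longrightarrow> \<psi> a = \<phi> j (t j f) a"
    "\<And>j f. j \<in> J \<Longrightarrow> f \<in> carrier G \<Longrightarrow> \<psi> (edge_element j f) = u j f"
proof -
  interpret L: group L by (rule L)
  have \<phi>_closed: "\<phi> j (t j f) a \<in> carrier L"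
    if "j \<in> J" "f \<in> carrier G" "a \<in> vertex_group j (t j f)" for j f a
    using \<phi>[OF that(1,2)] that(3) by (auto simp: hom_def)
  have \<phi>_one: "\<phi> j (t j f) \<one> = \<one>\<^bsub>L\<^esub>" if "j \<in> J" "f \<in> carrier G" for j f
    using hom_one[OF \<phi>[OF that] subgroup_imp_group L] vertex_group_subgroup that t_closed by simp
  define c where "c j k f = u j (k \<otimes> f) \<otimes>\<^bsub>L\<^esub> \<phi> j (t j f) (inv (s j (k \<otimes> f)) \<otimes> k \<otimes> s j f)
    \<otimes>\<^bsub>L\<^esub> inv\<^bsub>L\<^esub> (u j f)" for j k f
  obtain C where
    C_closed: "\<And>g f. g \<in> carrier G \<Longrightarrow> f \<in> carrier G \<Longrightarrow> C g f \<in> carrier L" and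
    C_right: "\<And>g f h. g \<in> carrier G \<Longrightarrow> f \<in> carrier G \<Longrightarrow> h \<in> H \<Longrightarrow> C g (f \<otimes> h) = C g f" and
    C_mult: "\<And>g g' f. g \<in> carrier G \<Longrightarrow> g' \<in> carrier G \<Longrightarrow> f \<in> carrier G \<Longrightarrow>
      C (g \<otimes> g') f = C g (g' \<otimes> f) \<otimes>\<^bsub>L\<^esub> C g' f" and
    C_K: "\<And>j k f. j \<in> J \<Longrightarrow> k \<in> K j \<Longrightarrow> f \<in> carrier G \<Longrightarrow> C k f = c j k f"
  proof (rule internal_free_product_cocycle[OF fp L subgroup.subset[OF H], of c])
    fix j k f assume j: "j \<in> J" and k: "k \<in> K j" and f: "f \<in> carrier G"
    show "c j k f \<in> carrier L"
      unfolding c_def using j k f u_closed K_closed \<phi>_closed[OF j f vertex_step[OF j f k]] by simp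
    show "c j k (f \<otimes> h) = c j k f" if h: "h \<in> H" for h
    proof -
      have "k \<otimes> (f \<otimes> h) = k \<otimes> f \<otimes> h" using j k f h K_closed H_closed by (simp add: m_assoc)
      then show ?thesis
        unfolding c_def using j k f h K_closed by (simp add: u_right s_right t_right)
    qed
    fix k' assume k': "k' \<in> K j"
    have kc: "k \<in> carrier G" "k' \<in> carrier G" using K_closed j k k' by auto
    have kf: "k' \<otimes> f \<in> carrier G" using kc f by simp
    let ?a = "inv (s j (k \<otimes> (k' \<otimes> f))) \<otimes> k \<otimes> s j (k' \<otimes> f)"
    let ?b = "inv (s j (k' \<otimes> f)) \<otimes> k' \<otimes> s j f"
    have a: "?a \<in> vertex_group j (t j f)" using vertex_step[OF j kf k] t_left[OF j f k'] by simp
    have b: "?b \<in> vertex_group j (t j f)" using vertex_step[OF j f k'] .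
    have "inv (s j (k \<otimes> k' \<otimes> f)) \<otimes> (k \<otimes> k') \<otimes> s j f = ?a \<otimes> ?b"
      using kc f j s_closed by (simp add: m_assoc)
    then have "\<phi> j (t j f) (inv (s j (k \<otimes> k' \<otimes> f)) \<otimes> (k \<otimes> k') \<otimes> s j f) =
        \<phi> j (t j f) ?a \<otimes>\<^bsub>L\<^esub> \<phi> j (t j f) ?b"
      using hom_mult[OF \<phi>[OF j f], of ?a ?b] a b by simp
    then show "c j (k \<otimes> k') f = c j k (k' \<otimes> f) \<otimes>\<^bsub>L\<^esub> c j k' f"
      unfolding c_def using kc f j t_left[OF j f k'] u_closed \<phi>_closed[OF j f a] \<phi>_closed[OF j f b]
      by (simp add: m_assoc L.m_assoc)
  qed blast
  have C_one: "C \<one> f = \<one>\<^bsub>L\<^esub>" if "f \<in> carrier G" for f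
    using C_mult[of \<one> \<one> f] C_closed[of \<one> f] that L.l_cancel_one by simp
  have u_t: "u j (t j f) = \<one>\<^bsub>L\<^esub>" if "j \<in> J" "f \<in> carrier G" for j f
    using that by (intro u_tree) (simp_all add: t_closed rep_t s_t)
  have C_t: "C k (t j f) = u j (k \<otimes> t j f) \<otimes>\<^bsub>L\<^esub> \<phi> j (t j f) (inv (s j (k \<otimes> t j f)) \<otimes> (k \<otimes> t j f))"
    if j: "j \<in> J" and f: "f \<in> carrier G" and k: "k \<in> K j" for j f k
  proof -
    have tc: "t j f \<in> carrier G" using j f by (rule t_closed)
    have kc: "k \<in> carrier G" using j k by (rule K_closed)
    have "inv (s j (k \<otimes> t j f)) \<otimes> (k \<otimes> t j f) \<in> vertex_group j (t j f)"
      using vertex_step[OF j tc k] j f tc kc s_closed by (simp add: t_t s_t m_assoc)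
    then show ?thesis
      using j f k tc kc C_K[OF j k tc] u_t u_closed \<phi>_closed[OF j f] s_closed
      by (simp add: c_def t_t s_t m_assoc)
  qed
  have s_s: "s j (s j f) = s j f" "u j (s j f) = u j f" if "j \<in> J" "f \<in> carrier G" for j f
    using s_mem[OF that] s_right u_right that by force+
  have C_s: "C k (t j f) = u j f"
    if j: "j \<in> J" and f: "f \<in> carrier G" and k: "k \<in> K j" "s j f = k \<otimes> t j f" for j f k
    using C_t[OF j f k(1)] j f by (simp add: s_s s_closed \<phi>_one u_closed flip: k(2))
  \<comment> \<open>Induction along the tree: a tree edge joins the coset of f to the shorter coset of t j f.\<close>
  have C_rep: "C (rep f) \<one> = \<one>\<^bsub>L\<^esub>" if "f \<in> carrier G" for f
    using that
  proof (induction "len (rep f)" arbitrary: f rule: less_induct)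
    case less
    show ?case
    proof (cases "rep f = \<one>")
      case True
      then show ?thesis using C_one by simp
    next
      case False
      then obtain j where j: "j \<in> J" "s j f = rep f" "len (t j f) < len (rep f)"
        using tree less.prems by blast
      obtain k where k: "k \<in> K j" "s j f = k \<otimes> t j f" using s_orbit j(1) less.prems by blast
      have tc: "t j f \<in> carrier G" and kc: "k \<in> carrier G"
        using j(1) less.prems k(1) t_closed K_closed by auto
      have "C (t j f) \<one> = \<one>\<^bsub>L\<^esub>"
        using less.hyps[of "t j f"] j less.prems by (simp add: rep_t t_closed)
      then have "C (k \<otimes> t j f) \<one> = C k (t j f)" using C_mult[of k "t j f" \<one>] C_closed tc kc by simp
      also have "\<dots> = \<one>\<^bsub>L\<^esub>" using C_s[OF j(1) less.prems k] u_tree j less.prems by simp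
      finally show ?thesis using j(2) k(2) by simp
    qed
  qed
  have C_tt: "C (t j f) \<one> = \<one>\<^bsub>L\<^esub>" if "j \<in> J" "f \<in> carrier G" for j f
    using C_rep[of "t j f"] that by (simp add: rep_t t_closed)
  \<comment> \<open>The way back along a path of trivial value has trivial value too.\<close>
  have C_inv: "C (inv g) (g \<otimes> h) = \<one>\<^bsub>L\<^esub>" if "g \<in> carrier G" "h \<in> H" "C g \<one> = \<one>\<^bsub>L\<^esub>" for g h
    using C_mult[of "inv g" g \<one>] C_right[of "inv g" g h] that C_closed C_one by simp
  show ?thesis
  proof (rule that[of "\<lambda>h. C h \<one>"])
    show "(\<lambda>h. C h \<one>) \<in> hom (G\<lparr>carrier := H\<rparr>) L"
    proof (rule homI)
      fix h h' assume "h \<in> carrier (G\<lparr>carrier := H\<rparr>)" "h' \<in> carrier (G\<lparr>carrier := H\<rparr>)"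
      then have h: "h \<in> H" "h' \<in> H" by auto
      then have "C h (\<one> \<otimes> h') = C h \<one>" using C_right[of h \<one> h'] H_closed by simp
      then show "C (h \<otimes>\<^bsub>G\<lparr>carrier := H\<rparr>\<^esub> h') \<one> = C h \<one> \<otimes>\<^bsub>L\<^esub> C h' \<one>"
        using h H_closed C_mult[of h h' \<one>] by simp
    qed (use C_closed H_closed in auto)
    fix j f assume j: "j \<in> J" and f: "f \<in> carrier G"
    show "C a \<one> = \<phi> j (t j f) a" if a: "a \<in> vertex_group j (t j f)" for a
    proof -
      let ?v = "t j f"
      have vc: "?v \<in> carrier G" using j f by (rule t_closed)
      have aH: "a \<in> H" and ac: "a \<in> carrier G" and k: "?v \<otimes> a \<otimes> inv ?v \<in> K j"
        using a H_closed by (auto simp: vertex_group_def)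
      let ?k = "?v \<otimes> a \<otimes> inv ?v"
      have kv: "?k \<otimes> ?v = ?v \<otimes> a" using vc ac by (simp add: m_assoc)
      have "C a \<one> = C (inv ?v \<otimes> (?k \<otimes> ?v)) \<one>" using vc ac kv by simp
      also have "\<dots> = C (inv ?v) (?v \<otimes> a) \<otimes>\<^bsub>L\<^esub> C (?k \<otimes> ?v) \<one>"
        using C_mult[of "inv ?v" "?v \<otimes> a" \<one>] vc ac kv by simp
      also have "\<dots> = C (?k \<otimes> ?v) \<one>"
        using C_inv[OF vc aH C_tt[OF j f]] C_closed vc ac by simp
      also have "\<dots> = C ?k ?v"
        using C_mult[of ?k ?v \<one>] C_closed vc ac C_tt[OF j f] by simp
      also have "\<dots> = \<phi> j ?v a"
        using C_t[OF j f k] s_right[OF j vc aH] u_right[OF j vc aH] s_t[OF j f] u_t[OF j f] vc ac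
          \<phi>_closed[OF j f a] by (simp add: kv)
      finally show ?thesis .
    qed
    show "C (edge_element j f) \<one> = u j f"
    proof -
      obtain k where k: "k \<in> K j" "s j f = k \<otimes> t j f" using s_orbit j f by blast
      have cl: "rep f \<in> carrier G" "s j f \<in> carrier G" "k \<in> carrier G" "t j f \<in> carrier G"
        using rep_closed s_closed j f k K_closed t_closed by auto
      have "s j f = rep f \<otimes> edge_element j f" using cl by (simp add: edge_element_def)
      then have "C (inv (rep f)) (s j f) = \<one>\<^bsub>L\<^esub>"
        using C_inv[OF cl(1) edge_element_mem[OF j f] C_rep[OF f]] by simp
      then have "C (edge_element j f) \<one> = C (s j f) \<one>"
        using C_mult[of "inv (rep f)" "s j f" \<one>] cl C_closed by (simp add: edge_element_def)
      also have "\<dots> = C k (t j f)"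
        using C_mult[of k "t j f" \<one>] cl C_closed C_tt[OF j f] k(2) by simp
      finally show ?thesis using C_s[OF j f k] by simp
    qed
  qed
qed

text \<open>Left indices stand for double cosets and right indices for edges. Tree edges are kept as indices
with a trivial factor; this spares a choice of the remaining edges.\<close>

definition kurosh_index :: "('j \<times> 'a + 'j \<times> 'a) set" where
  "kurosh_index = {Inl (j, t j f) | j f. j \<in> J \<and> f \<in> carrier G} \<union> {Inr (j, rep f) | j f. j \<in> J \<and> f \<in> carrier G}"

definition kurosh_factor :: "'j \<times> 'a + 'j \<times> 'a \<Rightarrow> 'a set" where
  "kurosh_factor i = (case i of Inl (j, v) \<Rightarrow> vertex_group j v | Inr (j, v) \<Rightarrow> generate G {edge_element j v})"

lemma edge_element_rep: "j \<in> J \<Longrightarrow> f \<in> carrier G \<Longrightarrow> edge_element j (rep f) = edge_element j f"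
  using rep_mem edge_element_right by force

lemma kurosh_factor_subgroup:
  assumes "i \<in> kurosh_index" shows "subgroup (kurosh_factor i) G" "kurosh_factor i \<subseteq> H"
proof -
  have "subgroup (kurosh_factor i) G \<and> kurosh_factor i \<subseteq> H"
    using assms unfolding kurosh_index_def
  proof (elim UnE CollectE exE conjE; hypsubst)
    fix j f assume j: "j \<in> J" and f: "f \<in> carrier G"
    show "subgroup (kurosh_factor (Inl (j, t j f))) G \<and> kurosh_factor (Inl (j, t j f)) \<subseteq> H"
      using vertex_group_subgroup[OF j t_closed[OF j f]] by (auto simp: kurosh_factor_def vertex_group_def)
    have e: "edge_element j f \<in> H" using j f by (rule edge_element_mem)
    then have "generate G {edge_element j f} \<subseteq> H" by (intro generate_subgroup_incl H) auto
    then show "subgroup (kurosh_factor (Inr (j, rep f))) G \<and> kurosh_factor (Inr (j, rep f)) \<subseteq> H"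
      using e H_closed j f
      by (auto simp: kurosh_factor_def edge_element_rep intro!: generate_is_subgroup)
  qed
  then show "subgroup (kurosh_factor i) G" "kurosh_factor i \<subseteq> H" by auto
qed

text \<open>Rewriting process of Reidemeister and Schreier: each letter of a word that represents \<open>h\<close> moves from
one coset to another, and comparing with the coset representatives turns it into an edge element,
an element of a vertex group, and the inverse of an edge element.\<close>

lemma kurosh_generate: "H \<subseteq> generate G (\<Union>i\<in>kurosh_index. kurosh_factor i)"
proof
  let ?U = "\<Union>i\<in>kurosh_index. kurosh_factor i"
  let ?B = "generate G ?U"
  have "?U \<subseteq> carrier G" using kurosh_factor_subgroup(1) by (auto dest: subgroup.subset)
  then have B: "subgroup ?B G" by (rule generate_is_subgroup)
  have vB: "a \<in> ?B" if "a \<in> vertex_group j (t j f)" "j \<in> J" "f \<in> carrier G" for a j f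
  proof -
    have "Inl (j, t j f) \<in> kurosh_index" using that by (auto simp: kurosh_index_def)
    then show ?thesis using that by (intro generate.incl UN_I) (auto simp: kurosh_factor_def)
  qed
  have eB: "edge_element j f \<in> ?B" if "j \<in> J" "f \<in> carrier G" for j f
  proof -
    have "Inr (j, rep f) \<in> kurosh_index" using that by (auto simp: kurosh_index_def)
    then show ?thesis using that
      by (intro generate.incl UN_I) (auto simp: kurosh_factor_def edge_element_rep intro: generate.incl)
  qed
  have step: "inv (rep (k \<otimes> f)) \<otimes> k \<otimes> rep f \<in> ?B" if j: "j \<in> J" and k: "k \<in> K j" and f: "f \<in> carrier G" for j k f
  proof -
    have kc: "k \<in> carrier G" using j k by (rule K_closed)
    then have kf: "k \<otimes> f \<in> carrier G" using f by simp
    have "inv (rep (k \<otimes> f)) \<otimes> k \<otimes> rep f = edge_element j (k \<otimes> f) \<otimes>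
        (inv (s j (k \<otimes> f)) \<otimes> k \<otimes> s j f) \<otimes> inv (edge_element j f)"
      using kc kf f j s_closed rep_closed by (simp add: edge_element_def m_assoc inv_mult_group)
    then show ?thesis
      using eB[OF j kf] eB[OF j f] vB[OF vertex_step[OF j f k] j f] B
      by (simp add: subgroup.m_closed subgroup.m_inv_closed)
  qed
  have walk: "x \<in> carrier G \<and> (\<forall>f\<in>carrier G. inv (rep (x \<otimes> f)) \<otimes> x \<otimes> rep f \<in> ?B)"
    if "x \<in> generate G (\<Union>j\<in>J. K j)" for x
    using that
  proof (induction rule: generate.induct)
    case one
    then show ?case using rep_closed subgroup.one_closed[OF B] by simp
  next
    case (incl k)
    then show ?case using step K_closed by auto
  next
    case (inv k)
    then show ?case using step K_closed subgroup.m_inv_closed[OF K_subgroup] inv_closed by blast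
  next
    case (eng x y)
    then have c: "x \<in> carrier G" "y \<in> carrier G" by auto
    have "inv (rep (x \<otimes> y \<otimes> f)) \<otimes> (x \<otimes> y) \<otimes> rep f \<in> ?B" if f: "f \<in> carrier G" for f
    proof -
      have "inv (rep (x \<otimes> y \<otimes> f)) \<otimes> (x \<otimes> y) \<otimes> rep f =
          (inv (rep (x \<otimes> (y \<otimes> f))) \<otimes> x \<otimes> rep (y \<otimes> f)) \<otimes> (inv (rep (y \<otimes> f)) \<otimes> y \<otimes> rep f)"
        using c f rep_closed by (simp add: m_assoc)
      then show ?thesis using eng f c subgroup.m_closed[OF B] by simp
    qed
    then show ?case using c by simp
  qed
  fix h assume h: "h \<in> H"
  then have "h \<in> generate G (\<Union>j\<in>J. K j)"
    using H_closed internal_free_product_generate[OF fp] by simp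
  from walk[OF this] have "inv (rep (h \<otimes> \<one>)) \<otimes> h \<otimes> rep \<one> \<in> ?B" by blast
  moreover have "rep h = \<one>" using rep_right[of \<one> h] rep_one h H_closed by simp
  ultimately show "h \<in> ?B" using h H_closed rep_one by simp
qed

text \<open>The extension property holds for arbitrary homomorphisms on the factors, because on a factor
generated by an edge element a homomorphism is determined by one value, which is trivial for tree
edges.\<close>

theorem kurosh_subgroup: "internal_free_product (G\<lparr>carrier := H\<rparr>) kurosh_index kurosh_factor"
proof (rule group.internal_free_productI[OF subgroup_imp_group[OF H]])
  let ?H = "G\<lparr>carrier := H\<rparr>"
  interpret GH: group ?H by (rule subgroup_imp_group[OF H])
  show sub: "subgroup (kurosh_factor i) ?H" if "i \<in> kurosh_index" for i
    using subgroup_incl[OF _ H] kurosh_factor_subgroup that by blast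
  have "generate ?H (\<Union>i\<in>kurosh_index. kurosh_factor i) = generate G (\<Union>i\<in>kurosh_index. kurosh_factor i)"
    by (rule generate_restrict[OF H]) (use kurosh_factor_subgroup(2) in blast)
  then show "carrier ?H \<subseteq> generate ?H (\<Union>i\<in>kurosh_index. kurosh_factor i)"
    using kurosh_generate by simp
  let ?P = "free_product kurosh_index (\<lambda>i. ?H\<lparr>carrier := kurosh_factor i\<rparr>)"
  fix \<phi> assume \<phi>: "\<And>i. i \<in> kurosh_index \<Longrightarrow> \<phi> i \<in> hom (?H\<lparr>carrier := kurosh_factor i\<rparr>) ?P"
  have P: "group ?P" by (rule group_free_product) (use GH.subgroup_imp_group sub in blast)
  have iV: "Inl (j, t j f) \<in> kurosh_index" and iE: "Inr (j, rep f) \<in> kurosh_index"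
    if "j \<in> J" "f \<in> carrier G" for j f using that by (auto simp: kurosh_index_def)
  have facV: "kurosh_factor (Inl (j, t j f)) = vertex_group j (t j f)" for j f
    by (simp add: kurosh_factor_def)
  have facE: "kurosh_factor (Inr (j, rep f)) = generate G {edge_element j f}"
    if "j \<in> J" "f \<in> carrier G" for j f using that by (simp add: kurosh_factor_def edge_element_rep)
  have \<phi>E: "\<phi> (Inr (j, rep f)) \<in> hom (G\<lparr>carrier := generate G {edge_element j f}\<rparr>) ?P"
    if "j \<in> J" "f \<in> carrier G" for j f using \<phi>[OF iE[OF that]] facE[OF that] by simp
  have subE: "subgroup (generate G {edge_element j f}) G" if "j \<in> J" "f \<in> carrier G" for j f
    using kurosh_factor_subgroup(1)[OF iE[OF that]] facE[OF that] by simp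
  have one_P: "\<phi> (Inr (j, rep f)) \<one> = \<one>\<^bsub>?P\<^esub>" if "j \<in> J" "f \<in> carrier G" for j f
    using hom_one[OF \<phi>E[OF that] subgroup_imp_group[OF subE[OF that]] P] by simp
  obtain \<psi> where \<psi>: "\<psi> \<in> hom ?H ?P"
    "\<And>j f a. j \<in> J \<Longrightarrow> f \<in> carrier G \<Longrightarrow> a \<in> vertex_group j (t j f) \<Longrightarrow> \<psi> a = \<phi> (Inl (j, t j f)) a"
    "\<And>j f. j \<in> J \<Longrightarrow> f \<in> carrier G \<Longrightarrow> \<psi> (edge_element j f) = \<phi> (Inr (j, rep f)) (edge_element j f)"
  proof (rule kurosh_extension[OF P, of "\<lambda>j v. \<phi> (Inl (j, v))" "\<lambda>j f. \<phi> (Inr (j, rep f)) (edge_element j f)"])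
    fix j f assume j: "j \<in> J" and f: "f \<in> carrier G"
    show "\<phi> (Inl (j, t j f)) \<in> hom (G\<lparr>carrier := vertex_group j (t j f)\<rparr>) ?P"
      using \<phi>[OF iV[OF j f]] by (simp add: facV)
    show "\<phi> (Inr (j, rep f)) (edge_element j f) \<in> carrier ?P"
      using \<phi>E[OF j f] by (auto simp: hom_def intro: generate.incl)
    show "\<phi> (Inr (j, rep (f \<otimes> h))) (edge_element j (f \<otimes> h)) = \<phi> (Inr (j, rep f)) (edge_element j f)"
      if "h \<in> H" for h using that j f by (simp add: rep_right edge_element_right)
    show "\<phi> (Inr (j, rep f)) (edge_element j f) = \<one>\<^bsub>?P\<^esub>" if "s j f = rep f"
      using one_P[OF j f] that f by (simp add: edge_element_def rep_closed)
  qed blast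
  have "\<psi> x = \<phi> i x" if i: "i \<in> kurosh_index" and x: "x \<in> kurosh_factor i" for i x
    using i unfolding kurosh_index_def
  proof (elim UnE CollectE exE conjE)
    fix j f assume "i = Inl (j, t j f)" "j \<in> J" "f \<in> carrier G"
    then show ?thesis using \<psi>(2) x facV by simp
  next
    fix j f assume e: "i = Inr (j, rep f)" and j: "j \<in> J" and f: "f \<in> carrier G"
    let ?E = "generate G {edge_element j f}"
    have E: "subgroup ?E G" "?E \<subseteq> H" using kurosh_factor_subgroup[OF iE[OF j f]] facE[OF j f] by auto
    have "generate (G\<lparr>carrier := ?E\<rparr>) {edge_element j f} = ?E"
      by (rule generate_restrict[OF E(1)]) (auto intro: generate.incl)
    moreover have "\<psi> \<in> hom (G\<lparr>carrier := ?E\<rparr>) ?P"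
      using hom_restrict_carrier[OF \<psi>(1), of ?E] E(2) by simp
    ultimately show ?thesis
      using hom_eq_on_generate[OF subgroup_imp_group[OF E(1)] P _ \<phi>E[OF j f], of \<psi> "{edge_element j f}" x]
        \<psi>(3)[OF j f] x e facE[OF j f] by (auto intro: generate.incl)
  qed
  then show "\<exists>\<psi>\<in>hom ?H ?P. \<forall>i\<in>kurosh_index. \<forall>x\<in>kurosh_factor i. \<psi> x = \<phi> i x"
    using \<psi>(1) by blast
qed

text \<open>Up to conjugation in \<open>H\<close>, the vertex groups contain all intersections of \<open>H\<close> with conjugates of the
factors. This is what preserves the marks given by conjugacy classes.\<close>

lemma conj_mem_vertex_group:
  assumes j: "j \<in> J" and k: "k \<in> K j" and f: "f \<in> carrier G" and h: "f \<otimes> k \<otimes> inv f \<in> H"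
  obtains h' where "h' \<in> H" "h' \<otimes> (f \<otimes> k \<otimes> inv f) \<otimes> inv h' \<in> vertex_group j (t j (inv f))"
proof -
  define v where "v = t j (inv f)"
  obtain k' h' where kh: "k' \<in> K j" "h' \<in> H" "inv f = k' \<otimes> v \<otimes> h'"
    using t_orbit[OF j, of "inv f"] f by (auto simp: v_def)
  have c: "k' \<in> carrier G" "k \<in> carrier G" "h' \<in> carrier G" "v \<in> carrier G"
    using kh k j f K_closed H_closed t_closed by (auto simp: v_def)
  have f': "f = inv h' \<otimes> (inv v \<otimes> inv k')"
    using c f inv_inv[OF f] by (simp add: kh(3) inv_mult_group)
  have "v \<otimes> (h' \<otimes> (f \<otimes> k \<otimes> inv f) \<otimes> inv h') \<otimes> inv v = inv k' \<otimes> k \<otimes> k'"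
    using c by (simp add: f' m_assoc inv_mult_group)
  then have "h' \<otimes> (f \<otimes> k \<otimes> inv f) \<otimes> inv h' \<in> vertex_group j v"
    using h kh k H K_subgroup[OF j] by (simp add: vertex_group_def subgroup.m_closed subgroup.m_inv_closed)
  then show ?thesis using that kh(2) by (simp add: v_def)
qed

end

text \<open>Measure a coset by the least length of a word for one of its elements, and a double coset by its
shortest coset \<open>Y\<close>. Deleting the first letter of a shortest word for \<open>f H\<close>, say a letter from \<open>K j\<close>,
gives a shorter coset in the same double coset, so that \<open>Y\<close> is shorter than \<open>f H\<close>. Hence the
representatives can be chosen by recursion on the length, that of \<open>f H\<close> being a \<open>K j\<close>-translate of
that of \<open>Y\<close>, which makes \<open>(j, f H)\<close> a tree edge.\<close>

lemma (in group) kurosh_system_exists: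
  assumes fp: "internal_free_product G J K" and H: "subgroup H G"
  obtains rep s t len where "kurosh_system G J K H rep s t len"
proof -
  let ?words = "fp_words J (\<lambda>j. G\<lparr>carrier := K j\<rparr>)"
  let ?eval = "word_eval G (\<lambda>_ x. x)"
  have HC: "h \<in> carrier G" if "h \<in> H" for h using H that by (rule subgroup.mem_carrier)
  have K: "subgroup (K j) G" if "j \<in> J" for j using fp that by (rule internal_free_product_subgroup)
  have KC: "k \<in> carrier G" if "j \<in> J" "k \<in> K j" for j k using K that by (meson subgroup.mem_carrier)
  define q where "q f = f <# H" for f
  have q_iff: "y \<in> q f \<longleftrightarrow> (\<exists>h\<in>H. y = f \<otimes> h)" for y f by (auto simp: q_def l_coset_def)
  have q_self: "f \<in> q f" if "f \<in> carrier G" for f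
    using that subgroup.one_closed[OF H] by (force simp: q_iff)
  have q_eq: "q y = q f" if "f \<in> carrier G" "y \<in> q f" for y f
    using l_repr_independence[of y f H] that H by (simp add: q_def)
  have q_right: "q (f \<otimes> h) = q f" if "f \<in> carrier G" "h \<in> H" for f h
    using that by (intro q_eq) (auto simp: q_iff)
  have q_closed: "y \<in> carrier G" if "f \<in> carrier G" "y \<in> q f" for y f
    using that HC by (auto simp: q_iff)
  have q_one: "q \<one> = H" using subgroup.subset[OF H] by (simp add: q_def lcos_mult_one)
  define L where "L x = (LEAST n. \<exists>w\<in>?words. length w = n \<and> ?eval w \<in> x)" for x
  have L_ex: "\<exists>w\<in>?words. length w = L (q f) \<and> ?eval w \<in> q f" if f: "f \<in> carrier G" for f
  proof -
    obtain w where "w \<in> ?words" "?eval w = f" using internal_free_product_eval[OF fp f] by blast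
    then have "\<exists>n. \<exists>w\<in>?words. length w = n \<and> ?eval w \<in> q f" using q_self f by blast
    then show ?thesis unfolding L_def by (rule LeastI_ex)
  qed
  have L_le: "L x \<le> length w" if "w \<in> ?words" "?eval w \<in> x" for w x
    unfolding L_def by (rule Least_le) (use that in blast)
  define Y where "Y j f = arg_min L (\<lambda>y. \<exists>k\<in>K j. y = q (k \<otimes> f))" for j f
  have one_K: "\<one> \<in> K j" if "j \<in> J" for j using K that by (meson subgroup.one_closed)
  have Y_mem: "\<exists>k\<in>K j. Y j f = q (k \<otimes> f)" if "j \<in> J" "f \<in> carrier G" for j f
    unfolding Y_def by (rule arg_min_natI[of _ "q (\<one> \<otimes> f)"]) (use one_K that in blast)
  have Y_le: "L (Y j f) \<le> L (q (k \<otimes> f))" if "k \<in> K j" for j f k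
    unfolding Y_def by (rule arg_min_nat_le) (use that in blast)
  have Y_right: "Y j (f \<otimes> h) = Y j f" if "j \<in> J" "f \<in> carrier G" "h \<in> H" for j f h
  proof -
    have "q (k \<otimes> (f \<otimes> h)) = q (k \<otimes> f)" if "k \<in> K j" for k
      using q_right[of "k \<otimes> f" h] KC[of j k] that \<open>j \<in> J\<close> \<open>f \<in> carrier G\<close> \<open>h \<in> H\<close> HC by (simp add: m_assoc)
    then have "(\<lambda>y. \<exists>k\<in>K j. y = q (k \<otimes> (f \<otimes> h))) = (\<lambda>y. \<exists>k\<in>K j. y = q (k \<otimes> f))" by auto
    then show ?thesis by (simp add: Y_def)
  qed
  have Y_left: "Y j (k \<otimes> f) = Y j f" if j: "j \<in> J" and f: "f \<in> carrier G" and k: "k \<in> K j" for j f k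
  proof -
    have "(\<exists>k'\<in>K j. y = q (k' \<otimes> (k \<otimes> f))) \<longleftrightarrow> (\<exists>k'\<in>K j. y = q (k' \<otimes> f))" for y
    proof
      assume "\<exists>k'\<in>K j. y = q (k' \<otimes> (k \<otimes> f))"
      then obtain k' where k': "k' \<in> K j" "y = q (k' \<otimes> (k \<otimes> f))" by blast
      then have "y = q ((k' \<otimes> k) \<otimes> f)" using KC j k f by (simp add: m_assoc)
      then show "\<exists>k'\<in>K j. y = q (k' \<otimes> f)" using subgroup.m_closed[OF K[OF j] k'(1) k] by blast
    next
      assume "\<exists>k'\<in>K j. y = q (k' \<otimes> f)"
      then obtain k' where k': "k' \<in> K j" "y = q (k' \<otimes> f)" by blast
      have "(k' \<otimes> inv k) \<otimes> (k \<otimes> f) = k' \<otimes> f" using KC j k k' f by (simp add: m_assoc)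
      then have "y = q ((k' \<otimes> inv k) \<otimes> (k \<otimes> f))" using k' by simp
      then show "\<exists>k'\<in>K j. y = q (k' \<otimes> (k \<otimes> f))"
        using subgroup.m_closed[OF K[OF j] k'(1) subgroup.m_inv_closed[OF K[OF j] k]] by blast
    qed
    then show ?thesis by (simp add: Y_def)
  qed
  \<comment> \<open>P r x v: the value v is admissible for the coset x, given the representatives r of shorter cosets.\<close>
  define P where "P r x v \<longleftrightarrow> x \<in> q ` carrier G \<longrightarrow> v \<in> x \<and> (x = H \<longrightarrow> v = \<one>) \<and>
    (x \<noteq> H \<longrightarrow> (\<exists>j\<in>J. \<exists>k\<in>K j. \<exists>f\<in>carrier G. x = q f \<and> L (Y j f) < L x \<and> v = k \<otimes> r (Y j f)))" for r x v
  have "\<exists>r. \<forall>x. P r x (r x)"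
  proof (rule dependent_wf_choice[of "measure L"])
    show "wf (measure L)" by simp
    show "P f x r = P g x r" if "\<And>z. (z, x) \<in> measure L \<Longrightarrow> f z = g z" for f g x r
    proof -
      have "(L z < L x \<and> r = k \<otimes> f z) = (L z < L x \<and> r = k \<otimes> g z)" for z k using that by auto
      then show ?thesis unfolding P_def by simp
    qed
    fix x r assume IH: "\<And>y. (y, x) \<in> measure L \<Longrightarrow> P r y (r y)"
    show "\<exists>v. P r x v"
    proof (cases "x = H \<or> x \<notin> q ` carrier G")
      case True
      then show ?thesis using subgroup.one_closed[OF H] by (auto simp: P_def)
    next
      case False
      then obtain f0 where f0: "f0 \<in> carrier G" "x = q f0" by blast
      obtain w where w: "w \<in> ?words" "length w = L x" "?eval w \<in> x"
        using L_ex[OF f0(1)] f0(2) by blast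
      have "w \<noteq> []"
      proof
        assume "w = []"
        then have "\<one> \<in> q f0" using w f0(2) by (simp add: word_eval_def)
        then have "q \<one> = q f0" using q_eq f0(1) by blast
        then show False using False f0(2) q_one by simp
      qed
      then obtain j k w' where w': "w = (j, k) # w'" by (cases w) auto
      let ?f = "?eval w'"
      have j: "j \<in> J" and k: "k \<in> K j" and w'_mem: "w' \<in> ?words" using w(1) w' by auto
      have f: "?f \<in> carrier G"
        using word_eval_in_generate[OF w'_mem] internal_free_product_generate[OF fp] by simp
      have kf: "k \<otimes> ?f \<in> carrier G" using f j k KC by simp
      have x: "x = q (k \<otimes> ?f)" using w(3) f0 q_eq by (simp add: w' word_eval_def)
      have "L (Y j ?f) \<le> L (q ?f)" using Y_le[OF one_K[OF j], of ?f] f by simp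
      also have "\<dots> \<le> length w'" using L_le[OF w'_mem q_self[OF f]] .
      also have "\<dots> < L x" using w(2) w' by simp
      finally have less: "L (Y j (k \<otimes> ?f)) < L x" using Y_left[OF j f k] by simp
      obtain k2 where k2: "k2 \<in> K j" "Y j (k \<otimes> ?f) = q (k2 \<otimes> ?f)" using Y_mem[OF j f] Y_left[OF j f k] by auto
      have c: "k \<in> carrier G" "k2 \<in> carrier G" using KC j k k2 by auto
      have "r (Y j (k \<otimes> ?f)) \<in> q (k2 \<otimes> ?f)"
        using IH[of "Y j (k \<otimes> ?f)"] less k2(2) c f by (simp add: P_def)
      then obtain h where h: "h \<in> H" "r (Y j (k \<otimes> ?f)) = k2 \<otimes> ?f \<otimes> h" by (auto simp: q_iff)
      have "(k \<otimes> inv k2) \<otimes> r (Y j (k \<otimes> ?f)) = (k \<otimes> ?f) \<otimes> h"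
        using h c f HC by (simp add: m_assoc)
      then have "(k \<otimes> inv k2) \<otimes> r (Y j (k \<otimes> ?f)) \<in> x" using h(1) by (auto simp: x q_iff)
      moreover have "k \<otimes> inv k2 \<in> K j"
        using K j k k2(1) by (meson subgroup.m_closed subgroup.m_inv_closed)
      ultimately have "P r x ((k \<otimes> inv k2) \<otimes> r (Y j (k \<otimes> ?f)))"
        unfolding P_def using False less x kf j by blast
      then show ?thesis by blast
    qed
  qed
  then obtain r where r: "\<And>x. P r x (r x)" by blast
  define rep where "rep f = r (q f)" for f
  define t where "t j f = r (Y j f)" for j f
  define s where "s j f = (if \<exists>k\<in>K j. rep f = k \<otimes> t j f then rep f
    else SOME z. z \<in> q f \<and> (\<exists>k\<in>K j. z = k \<otimes> t j f))" for j f
  have rep_q: "rep f \<in> q f" if "f \<in> carrier G" for f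
    using r[of "q f"] that by (simp add: P_def rep_def)
  have t_mem: "\<exists>k\<in>K j. \<exists>h\<in>H. Y j f = q (t j f) \<and> t j f = k \<otimes> f \<otimes> h" if j: "j \<in> J" and f: "f \<in> carrier G" for j f
  proof -
    obtain k where k: "k \<in> K j" "Y j f = q (k \<otimes> f)" using Y_mem j f by blast
    then have kf: "k \<otimes> f \<in> carrier G" using KC j f by simp
    then have "t j f \<in> q (k \<otimes> f)" using rep_q k(2) by (simp add: t_def rep_def)
    moreover from this have "Y j f = q (t j f)" using q_eq kf k(2) by simp
    ultimately show ?thesis using k(1) q_iff by auto
  qed
  have t_closed: "t j f \<in> carrier G" if "j \<in> J" "f \<in> carrier G" for j f
    using t_mem[OF that] that KC HC by force
  have t_left: "t j (k \<otimes> f) = t j f" if "j \<in> J" "f \<in> carrier G" "k \<in> K j" for j f k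
    using that by (simp add: t_def Y_left)
  have t_right: "t j (f \<otimes> h) = t j f" if "j \<in> J" "f \<in> carrier G" "h \<in> H" for j f h
    using that by (simp add: t_def Y_right)
  have rep_right: "rep (f \<otimes> h) = rep f" if "f \<in> carrier G" "h \<in> H" for f h
    using that by (simp add: rep_def q_right)
  have rep_t: "rep (t j f) = t j f" if "j \<in> J" "f \<in> carrier G" for j f
    using t_mem[OF that] by (auto simp: rep_def t_def)
  have s_prop: "s j f \<in> q f \<and> (\<exists>k\<in>K j. s j f = k \<otimes> t j f)" if j: "j \<in> J" and f: "f \<in> carrier G" for j f
  proof (cases "\<exists>k\<in>K j. rep f = k \<otimes> t j f")
    case True
    then show ?thesis using rep_q f by (simp add: s_def)
  next
    case False
    obtain k h where kh: "k \<in> K j" "h \<in> H" "t j f = k \<otimes> f \<otimes> h" using t_mem j f by blast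
    have "inv k \<otimes> t j f = f \<otimes> h" using kh j f KC HC by (simp add: m_assoc)
    then have "\<exists>z. z \<in> q f \<and> (\<exists>k\<in>K j. z = k \<otimes> t j f)"
      using kh subgroup.m_inv_closed[OF K[OF j]] q_iff by metis
    then show ?thesis unfolding s_def if_not_P[OF False] by (rule someI_ex)
  qed
  have "kurosh_system G J K H rep s t (\<lambda>f. L (q f))"
  proof (intro kurosh_system.intro kurosh_system_axioms.intro is_group)
    show "internal_free_product G J K" by (rule fp)
    show "subgroup H G" by (rule H)
    show "\<exists>h\<in>H. rep f = f \<otimes> h" if "f \<in> carrier G" for f using rep_q[OF that] q_iff by blast
    show "rep (f \<otimes> h) = rep f" if "f \<in> carrier G" "h \<in> H" for f h using that by (rule rep_right)
    show "rep \<one> = \<one>" using r[of "q \<one>"] q_one by (auto simp: P_def rep_def)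
    show "t j f \<in> carrier G" if "j \<in> J" "f \<in> carrier G" for j f using that by (rule t_closed)
    show "t j (k \<otimes> f) = t j f" if "j \<in> J" "f \<in> carrier G" "k \<in> K j" for j f k using that by (rule t_left)
    show "t j (f \<otimes> h) = t j f" if "j \<in> J" "f \<in> carrier G" "h \<in> H" for j f h using that by (rule t_right)
    show "rep (t j f) = t j f" if "j \<in> J" "f \<in> carrier G" for j f using that by (rule rep_t)
    \<comment> \<open>The coset H is the only one of length zero, hence it represents its double cosets.\<close>
    show "t j \<one> = \<one>" if j: "j \<in> J" for j
    proof -
      have "L (Y j \<one>) \<le> L (q \<one>)" using Y_le[OF one_K[OF j], of \<one>] by simp
      also have "\<dots> \<le> 0" using L_le[of "[]" "q \<one>"] q_self[of \<one>] by (simp add: word_eval_def)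
      finally have L0: "L (q (t j \<one>)) = 0" using t_mem[OF j, of \<one>] by auto
      have tc: "t j \<one> \<in> carrier G" using t_closed j by simp
      then have "\<one> \<in> q (t j \<one>)" using L_ex[OF tc] L0 by (simp add: word_eval_def)
      then have "q (t j \<one>) = H" using q_eq[OF tc] q_one by simp
      then have "rep (t j \<one>) = \<one>" using r[of "q \<one>"] q_one by (auto simp: P_def rep_def)
      then show ?thesis using rep_t j by simp
    qed
    show "\<exists>h\<in>H. s j f = f \<otimes> h" if "j \<in> J" "f \<in> carrier G" for j f using s_prop[OF that] q_iff by blast
    show "s j (f \<otimes> h) = s j f" if "j \<in> J" "f \<in> carrier G" "h \<in> H" for j f h
      unfolding s_def using that by (simp add: rep_right t_right q_right)
    show "\<exists>k\<in>K j. s j f = k \<otimes> t j f" if "j \<in> J" "f \<in> carrier G" for j f using s_prop[OF that] by blast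
    show "s j (t j f) = t j f" if j: "j \<in> J" and f: "f \<in> carrier G" for j f
    proof -
      obtain k h where kh: "k \<in> K j" "h \<in> H" "t j f = k \<otimes> f \<otimes> h" using t_mem j f by blast
      have "t j (k \<otimes> f \<otimes> h) = t j f" using kh(1,2) j f KC by (simp add: t_left t_right)
      then have "t j (t j f) = t j f" by (simp flip: kh(3))
      then have "\<exists>k\<in>K j. rep (t j f) = k \<otimes> t j (t j f)"
        using rep_t[OF j f] one_K[OF j] t_closed[OF j f] by (intro bexI[of _ \<one>]) simp_all
      then show ?thesis using rep_t[OF j f] by (simp add: s_def)
    qed
    show "\<exists>j\<in>J. s j f = rep f \<and> L (q (t j f)) < L (q (rep f))" if f: "f \<in> carrier G" and ne: "rep f \<noteq> \<one>" for f
    proof -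
      have "q f \<noteq> H" using r[of "q f"] ne f by (auto simp: P_def rep_def)
      then have "\<exists>j\<in>J. \<exists>k\<in>K j. \<exists>f'\<in>carrier G. q f = q f' \<and> L (Y j f') < L (q f) \<and> r (q f) = k \<otimes> r (Y j f')"
        using r[of "q f"] f unfolding P_def by blast
      then obtain j k f' where jk: "j \<in> J" "k \<in> K j" "f' \<in> carrier G" "q f = q f'" "L (Y j f') < L (q f)"
        "rep f = k \<otimes> r (Y j f')"
        unfolding rep_def by blast
      have "f' \<in> q f" using q_self[OF jk(3)] jk(4) by simp
      then obtain h where "h \<in> H" "f' = f \<otimes> h" using q_iff by blast
      then have Y: "Y j f' = Y j f" using Y_right jk(1) f by simp
      then have "rep f = k \<otimes> t j f" using jk(6) by (simp add: t_def)
      then have "s j f = rep f" using jk(2) unfolding s_def by (intro if_P) blast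
      moreover have "q (rep f) = q f" using q_eq[OF f rep_q[OF f]] .
      moreover have "q (t j f) = Y j f" using t_mem[OF jk(1) f] by auto
      ultimately show ?thesis using jk(1,5) Y by (intro bexI[of _ j]) simp_all
    qed
  qed
  then show ?thesis by (rule that)
qed

section \<open>Free groups\<close>

definition signed_letter :: "('a, 'b) monoid_scheme \<Rightarrow> ('s \<Rightarrow> 'a) \<Rightarrow> 's \<Rightarrow> bool \<Rightarrow> 'a" where
  "signed_letter G u s b = (if b then u s else inv\<^bsub>G\<^esub> (u s))"

lemma word_eval_Cons: "word_eval G \<phi> ((i, x) # w) = \<phi> i x \<otimes>\<^bsub>G\<^esub> word_eval G \<phi> w"
  by (simp add: word_eval_def)

lemma word_eval_Nil: "word_eval G \<phi> [] = \<one>\<^bsub>G\<^esub>"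
  by (simp add: word_eval_def)

context group
begin

lemma signed_letter_closed: "u s \<in> carrier G \<Longrightarrow> signed_letter G u s b \<in> carrier G"
  by (simp add: signed_letter_def)

lemma signed_eval_closed:
  assumes "u \<in> S \<rightarrow> carrier G" "w \<in> lists (S \<times> UNIV)"
  shows "word_eval G (signed_letter G u) w \<in> carrier G"
  using assms(2)
proof (induction w)
  case (Cons p w)
  obtain s b where p: "p = (s, b)" by force
  then have "signed_letter G u s b \<in> carrier G" using Cons.hyps assms(1) by (auto intro!: signed_letter_closed)
  then show ?case using Cons.IH p by (simp add: word_eval_Cons)
qed (simp add: word_eval_Nil)

lemma signed_eval_append:
  assumes "u \<in> S \<rightarrow> carrier G" "v \<in> lists (S \<times> UNIV)" "w \<in> lists (S \<times> UNIV)"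
  shows "word_eval G (signed_letter G u) (v @ w) = word_eval G (signed_letter G u) v \<otimes> word_eval G (signed_letter G u) w"
  using assms(2)
proof (induction v)
  case Nil
  then show ?case using signed_eval_closed[OF assms(1,3)] by (simp add: word_eval_Nil)
next
  case (Cons p v)
  obtain s b where p: "p = (s, b)" by force
  have "signed_letter G u s b \<in> carrier G" using Cons.hyps assms(1) p by (auto intro!: signed_letter_closed)
  then show ?case
    using Cons p signed_eval_closed[OF assms(1)] assms(3) by (simp add: word_eval_Cons m_assoc)
qed

text \<open>The two evaluations are treated together because one and the same reduced word has to serve in both
groups; this is what makes the map of \<open>free_basis_extend\<close> multiplicative.\<close>

lemma reduce_word:
  assumes L: "group L" and u: "u \<in> S \<rightarrow> carrier G" and u': "u' \<in> S \<rightarrow> carrier L"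
    and "w \<in> lists (S \<times> UNIV)"
  shows "\<exists>v\<in>reduced_words S. word_eval G (signed_letter G u) v = word_eval G (signed_letter G u) w \<and>
    word_eval L (signed_letter L u') v = word_eval L (signed_letter L u') w"
  using assms(4)
proof (induction w)
  case Nil
  have "[] \<in> reduced_words S" by (simp add: reduced_words_def)
  then show ?case by blast
next
  case (Cons p w)
  interpret L: group L by (rule L)
  obtain s b where p: "p = (s, b)" by force
  with Cons.hyps have s: "s \<in> S" by auto
  from Cons.IH obtain v where v: "v \<in> reduced_words S"
    "word_eval G (signed_letter G u) v = word_eval G (signed_letter G u) w"
    "word_eval L (signed_letter L u') v = word_eval L (signed_letter L u') w" by blast
  show ?case
  proof (cases "\<exists>v'. v = (s, \<not> b) # v'")
    case True
    then obtain v' where v': "v = (s, \<not> b) # v'" by blast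
    then have red: "v' \<in> reduced_words S" using v(1) by (auto simp: reduced_words_def successively_Cons)
    then have v'l: "v' \<in> lists (S \<times> UNIV)" by (simp add: reduced_words_def)
    have c: "word_eval G (signed_letter G u) v' \<in> carrier G" "word_eval L (signed_letter L u') v' \<in> carrier L"
      "u s \<in> carrier G" "u' s \<in> carrier L"
      using signed_eval_closed[OF u v'l] L.signed_eval_closed[OF u' v'l] funcset_mem[OF u s] funcset_mem[OF u' s]
      by simp_all
    have "word_eval G (signed_letter G u) w = signed_letter G u s (\<not> b) \<otimes> word_eval G (signed_letter G u) v'"
      "word_eval L (signed_letter L u') w = signed_letter L u' s (\<not> b) \<otimes>\<^bsub>L\<^esub> word_eval L (signed_letter L u') v'"
      using v(2,3) v' by (simp_all add: word_eval_Cons)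
    then show ?thesis
      using c p by (intro bexI[OF _ red]) (cases b; simp add: word_eval_Cons signed_letter_def[of G u s] signed_letter_def[of L u' s])
  next
    case False
    have "p # v \<in> reduced_words S"
      using v(1) s p False by (cases v) (auto simp: reduced_words_def successively_Cons)
    then show ?thesis using v(2,3) p by (intro bexI[of _ "p # v"]) (simp_all add: word_eval_Cons)
  qed
qed

lemma free_basis_iff:
  "free_basis G S \<longleftrightarrow> S \<subseteq> carrier G \<and> bij_betw (word_eval G (signed_letter G (\<lambda>s. s))) (reduced_words S) (carrier G)"
proof -
  have "(\<lambda>s b. if b then s else inv s) = signed_letter G (\<lambda>s. s)" by (simp add: fun_eq_iff signed_letter_def)
  then show ?thesis by (simp add: free_basis_def)
qed

text \<open>Evaluate in \<open>L\<close> the reduced word of an element of \<open>G\<close>.\<close>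

lemma free_basis_extend:
  assumes S: "free_basis G S" and L: "group L" and u: "u \<in> S \<rightarrow> carrier L"
  obtains \<psi> where "\<psi> \<in> hom G L" "\<And>s. s \<in> S \<Longrightarrow> \<psi> s = u s"
proof -
  interpret L: group L by (rule L)
  let ?e = "word_eval G (signed_letter G (\<lambda>s. s))" and ?e' = "word_eval L (signed_letter L u)"
  have bij: "bij_betw ?e (reduced_words S) (carrier G)" and SC: "S \<subseteq> carrier G"
    using S by (auto simp: free_basis_iff)
  have id: "(\<lambda>s. s) \<in> S \<rightarrow> carrier G" using SC by auto
  define \<psi> where "\<psi> g = ?e' (inv_into (reduced_words S) ?e g)" for g
  have \<psi>_eval: "\<psi> (?e w) = ?e' w" if "w \<in> reduced_words S" for w
    using bij that by (simp add: \<psi>_def bij_betw_def)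
  have rl: "w \<in> lists (S \<times> UNIV)" if "w \<in> reduced_words S" for w using that by (simp add: reduced_words_def)
  have ex: "\<exists>w\<in>reduced_words S. g = ?e w" if "g \<in> carrier G" for g
    using bij that by (auto simp: bij_betw_def)
  have "\<psi> \<in> hom G L"
  proof (rule homI)
    fix g assume "g \<in> carrier G"
    then obtain w where w: "w \<in> reduced_words S" "g = ?e w" using ex by blast
    then show "\<psi> g \<in> carrier L" using \<psi>_eval rl L.signed_eval_closed u by metis
    fix h assume "h \<in> carrier G"
    then obtain v where v: "v \<in> reduced_words S" "h = ?e v" using ex by blast
    obtain z where z: "z \<in> reduced_words S" "?e z = ?e (w @ v)" "?e' z = ?e' (w @ v)"
      using reduce_word[OF L id u, of "w @ v"] rl w v by auto
    have "g \<otimes> h = ?e z" using w v z(2) signed_eval_append[OF id] rl by simp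
    then have "\<psi> (g \<otimes> h) = ?e' z" using \<psi>_eval z(1) by simp
    then show "\<psi> (g \<otimes> h) = \<psi> g \<otimes>\<^bsub>L\<^esub> \<psi> h"
      using w v z(3) L.signed_eval_append[OF u] rl \<psi>_eval by simp
  qed
  moreover have "\<psi> s = u s" if s: "s \<in> S" for s
  proof -
    have "[(s, True)] \<in> reduced_words S" using s by (simp add: reduced_words_def)
    moreover have "?e [(s, True)] = s" "?e' [(s, True)] = u s"
      using s SC funcset_mem[OF u s] by (auto simp: word_eval_def signed_letter_def)
    ultimately show ?thesis using \<psi>_eval by metis
  qed
  ultimately show ?thesis using that by blast
qed

lemma free_basis_generate:
  assumes S: "free_basis G S" shows "generate G S = carrier G"
proof
  have SC: "S \<subseteq> carrier G" using S by (simp add: free_basis_iff)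
  then show "generate G S \<subseteq> carrier G" by (rule generate_incl)
  have gen: "word_eval G (signed_letter G (\<lambda>s. s)) w \<in> generate G S" if "w \<in> lists (S \<times> UNIV)" for w
    using that
    by (induction w)
      (auto simp: word_eval_Cons word_eval_Nil signed_letter_def intro!: generate.eng intro: generate.intros)
  show "carrier G \<subseteq> generate G S"
  proof
    fix x assume "x \<in> carrier G"
    then have "x \<in> word_eval G (signed_letter G (\<lambda>s. s)) ` reduced_words S"
      using S by (simp add: free_basis_iff bij_betw_def)
    then obtain w where "w \<in> reduced_words S" "x = word_eval G (signed_letter G (\<lambda>s. s)) w" by blast
    then show "x \<in> generate G S" using gen[of w] by (simp add: reduced_words_def)
  qed
qed

lemma free_basis_internal_free_product:
  assumes S: "free_basis G S"
  shows "internal_free_product G S (\<lambda>s. generate G {s})"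
proof (rule internal_free_productI)
  have SC: "S \<subseteq> carrier G" using S by (simp add: free_basis_iff)
  then show sub: "subgroup (generate G {s}) G" if "s \<in> S" for s
    using that by (intro generate_is_subgroup) auto
  have "S \<subseteq> (\<Union>s\<in>S. generate G {s})" by (auto intro: generate.incl)
  then show "carrier G \<subseteq> generate G (\<Union>s\<in>S. generate G {s})"
    using mono_generate free_basis_generate[OF S] by metis
  let ?P = "free_product S (\<lambda>s. G\<lparr>carrier := generate G {s}\<rparr>)"
  have P: "group ?P" by (rule group_free_product) (use sub subgroup_imp_group in blast)
  fix \<phi> assume \<phi>: "\<And>s. s \<in> S \<Longrightarrow> \<phi> s \<in> hom (G\<lparr>carrier := generate G {s}\<rparr>) ?P"
  have "(\<lambda>s. \<phi> s s) \<in> S \<rightarrow> carrier ?P" using \<phi> by (auto simp: hom_def intro: generate.incl)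
  then obtain \<psi> where \<psi>: "\<psi> \<in> hom G ?P" "\<And>s. s \<in> S \<Longrightarrow> \<psi> s = \<phi> s s"
    using free_basis_extend[OF S P] by blast
  have "\<psi> x = \<phi> s x" if s: "s \<in> S" and x: "x \<in> generate G {s}" for s x
  proof (rule hom_eq_on_generate[OF subgroup_imp_group[OF sub[OF s]] P _ \<phi>[OF s]])
    show "\<psi> \<in> hom (G\<lparr>carrier := generate G {s}\<rparr>) ?P"
      using \<psi>(1) subgroup.subset[OF sub[OF s]] by (rule hom_restrict_carrier)
    have "generate (G\<lparr>carrier := generate G {s}\<rparr>) {s} = generate G {s}"
      by (rule generate_restrict[OF sub[OF s]]) (simp add: generate.incl)
    then show "x \<in> generate (G\<lparr>carrier := generate G {s}\<rparr>) {s}" using x by simp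
  qed (use \<psi>(2) s in \<open>auto intro: generate.incl\<close>)
  then show "\<exists>\<psi>\<in>hom G ?P. \<forall>s\<in>S. \<forall>x\<in>generate G {s}. \<psi> x = \<phi> s x" using \<psi>(1) by blast
qed

lemma inj_on_generate_of_degree_one:
  assumes \<delta>: "\<delta> \<in> hom G integer_group" and a: "a \<in> carrier G" and one: "\<delta> a = 1"
  shows "inj_on \<delta> (generate G {a})"
proof -
  interpret d: group_hom G integer_group \<delta>
    using \<delta> by (simp add: group_hom_def group_hom_axioms_def is_group)
  have "\<delta> (a [^] k) = k" for k :: int using d.hom_int_pow[OF a, of k] one by simp
  then show ?thesis by (auto simp: generate_pow[OF a] inj_on_def)
qed

text \<open>A subgroup of an infinite cyclic group is generated by an element of least positive degree.\<close>

lemma free_group_of_rank_one: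
  assumes \<delta>: "\<delta> \<in> hom G integer_group" and inj: "inj_on \<delta> (carrier G)" and nt: "carrier G \<noteq> {\<one>}"
  shows "free_group_of_rank G 1"
proof -
  interpret d: group_hom G integer_group \<delta>
    using \<delta> by (simp add: group_hom_def group_hom_axioms_def is_group)
  obtain g where g: "g \<in> carrier G" "g \<noteq> \<one>" using nt by auto
  then have "\<delta> g \<noteq> 0" using inj_onD[OF inj, of g \<one>] d.hom_one by auto
  then have ex: "\<exists>n. n > 0 \<and> (\<exists>a\<in>carrier G. \<delta> a = int n)"
    using g(1) d.hom_inv[OF g(1)] inv_closed[OF g(1)]
    by (cases "\<delta> g > 0") (metis nat_0_le zero_less_nat_eq order_less_imp_le,
        metis inv_integer_group linorder_neqE_linordered_idom neg_0_less_iff_less nat_0_le zero_less_nat_eq order_less_imp_le)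
  define d where "d = (LEAST n. n > 0 \<and> (\<exists>a\<in>carrier G. \<delta> a = int n))"
  have d: "d > 0" "\<exists>a\<in>carrier G. \<delta> a = int d" using LeastI_ex[OF ex] by (simp_all add: d_def)
  have d_le: "d \<le> n" if "n > 0" "a \<in> carrier G" "\<delta> a = int n" for n a
    unfolding d_def by (rule Least_le) (use that in blast)
  obtain a where a: "a \<in> carrier G" "\<delta> a = int d" using d(2) by blast
  let ?e = "word_eval G (signed_letter G (\<lambda>s. s))"
  let ?rep = "\<lambda>n b. replicate n (a, b)"
  have e: "?e (?rep n b) \<in> carrier G \<and> \<delta> (?e (?rep n b)) = (if b then int n else - int n) * int d" for n b
    by (induction n) (use a in \<open>auto simp: word_eval_Nil word_eval_Cons signed_letter_def algebra_simps\<close>)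
  have red: "reduced_words {a} = {?rep n b | n b. True}"
  proof
    show "{?rep n b | n b. True} \<subseteq> reduced_words {a}"
    proof clarify
      fix n b show "?rep n b \<in> reduced_words {a}"
        by (induction n) (auto simp: reduced_words_def successively_Cons)
    qed
    show "reduced_words {a} \<subseteq> {?rep n b | n b. True}"
    proof
      fix w assume "w \<in> reduced_words {a}"
      then show "w \<in> {?rep n b | n b. True}"
      proof (induction w)
        case Nil
        have "[] = ?rep 0 True" by simp
        then show ?case by blast
      next
        case (Cons p w)
        then have w: "w \<in> reduced_words {a}" by (auto simp: reduced_words_def successively_Cons)
        obtain b where p: "p = (a, b)" using Cons.prems by (cases p) (auto simp: reduced_words_def)
        obtain n c where n: "w = ?rep n c" using Cons.IH[OF w] by blast
        have "p # w = ?rep (Suc n) b"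
          using Cons.prems n p by (cases n) (auto simp: reduced_words_def)
        then show ?case by blast
      qed
    qed
  qed
  have "inj_on ?e (reduced_words {a})"
  proof (rule inj_onI)
    fix v w assume "v \<in> reduced_words {a}" "w \<in> reduced_words {a}" and eq: "?e v = ?e w"
    then obtain n b m c where vw: "v = ?rep n b" "w = ?rep m c" using red by auto
    have "\<delta> (?e v) = \<delta> (?e w)" using eq by simp
    then have "(if b then int n else - int n) * int d = (if c then int m else - int m) * int d"
      using e vw by metis
    then have "(if b then int n else - int n) = (if c then int m else - int m)" using d(1) by simp
    then have "n = m \<and> (n = 0 \<or> b = c)" by (auto split: if_splits)
    then show "v = w" using vw by auto
  qed
  moreover have "?e ` reduced_words {a} = carrier G"
  proof
    show "?e ` reduced_words {a} \<subseteq> carrier G" using e red by auto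
    show "carrier G \<subseteq> ?e ` reduced_words {a}"
    proof
      fix x assume x: "x \<in> carrier G"
      define k where "k = \<delta> x div int d"
      define y where "y = ?e (?rep (nat \<bar>k\<bar>) (k \<ge> 0))"
      have y: "y \<in> carrier G" "\<delta> y = k * int d" using e[of "nat \<bar>k\<bar>" "k \<ge> 0"] by (auto simp: y_def)
      have "\<delta> (x \<otimes> inv y) = \<delta> x - \<delta> x div int d * int d" using x y by (simp add: k_def)
      also have "\<dots> = \<delta> x mod int d" by (simp add: minus_div_mult_eq_mod)
      finally have m: "\<delta> (x \<otimes> inv y) = int (nat (\<delta> x mod int d))" using d(1) by simp
      have "\<not> nat (\<delta> x mod int d) > 0"
      proof
        assume "nat (\<delta> x mod int d) > 0"
        then have "d \<le> nat (\<delta> x mod int d)"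
          using d_le[of _ "x \<otimes> inv y"] m x y by simp
        moreover have "\<delta> x mod int d < int d" using d(1) by simp
        ultimately show False using d(1) by linarith
      qed
      then have "\<delta> (x \<otimes> inv y) = \<delta> \<one>" using m d.hom_one by simp
      then have "x \<otimes> inv y = \<one>" using inj_onD[OF inj] x y by simp
      then have "x = y" using x y by (metis inv_equality inv_inv inv_closed)
      then show "x \<in> ?e ` reduced_words {a}" using red by (auto simp: y_def)
    qed
  qed
  ultimately have "free_basis G {a}" using a(1) by (simp add: free_basis_iff bij_betw_def)
  then show ?thesis using is_group by (auto simp: free_group_of_rank_def intro!: exI[of _ "{a}"])
qed

end

text \<open>Applied to the cyclic factors given by a basis, this replaces the theorem of Nielsen and Schreier.
A vertex group is conjugate into some \<open>K j\<close>, so it inherits an injective degree. For an edge factor,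
\<open>kurosh_extension\<close> gives a homomorphism from \<open>H\<close> to the integers with value 1 on the edge element.\<close>

lemma (in kurosh_system) kurosh_factor_rank_one:
  assumes cyc: "\<And>j. j \<in> J \<Longrightarrow> \<exists>\<delta>\<in>hom G integer_group. inj_on \<delta> (K j)"
    and i: "i \<in> kurosh_index" and nt: "kurosh_factor i \<noteq> {\<one>}"
  shows "free_group_of_rank (G\<lparr>carrier := kurosh_factor i\<rparr>) 1"
proof -
  let ?A = "kurosh_factor i"
  have A: "subgroup ?A G" "?A \<subseteq> H" using kurosh_factor_subgroup[OF i] by auto
  have "\<exists>\<delta>\<in>hom (G\<lparr>carrier := ?A\<rparr>) integer_group. inj_on \<delta> ?A"
    using i unfolding kurosh_index_def
  proof (elim UnE CollectE exE conjE)
    fix j f assume e: "i = Inl (j, t j f)" and j: "j \<in> J" and f: "f \<in> carrier G"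
    obtain \<delta> where \<delta>: "\<delta> \<in> hom G integer_group" "inj_on \<delta> (K j)" using cyc[OF j] by blast
    interpret d: group_hom G integer_group \<delta>
      using \<delta>(1) by (simp add: group_hom_def group_hom_axioms_def is_group)
    let ?v = "t j f"
    have v: "?v \<in> carrier G" using j f by (rule t_closed)
    have "inj_on \<delta> ?A"
    proof (rule inj_onI)
      fix a b assume "a \<in> ?A" "b \<in> ?A" and eq: "\<delta> a = \<delta> b"
      then have ab: "a \<in> carrier G" "b \<in> carrier G" "?v \<otimes> a \<otimes> inv ?v \<in> K j" "?v \<otimes> b \<otimes> inv ?v \<in> K j"
        using H_closed by (auto simp: e kurosh_factor_def vertex_group_def)
      have "\<delta> (?v \<otimes> a \<otimes> inv ?v) = \<delta> (?v \<otimes> b \<otimes> inv ?v)" using ab v eq by simp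
      then have "?v \<otimes> a \<otimes> inv ?v = ?v \<otimes> b \<otimes> inv ?v" using inj_onD[OF \<delta>(2)] ab by blast
      then show "a = b" using ab v by simp
    qed
    then show ?thesis using hom_restrict_carrier[OF \<delta>(1) subgroup.subset[OF A(1)]] by blast
  next
    fix j f assume e: "i = Inr (j, rep f)" and j: "j \<in> J" and f: "f \<in> carrier G"
    let ?g = "edge_element j f"
    have A_eq: "?A = generate G {?g}" using j f by (simp add: e kurosh_factor_def edge_element_rep)
    have "s j f \<noteq> rep f"
    proof
      assume "s j f = rep f"
      then have "?g = \<one>" using f by (simp add: edge_element_def rep_closed)
      then show False using nt A_eq by (simp add: generate_one)
    qed
    moreover obtain \<psi> where \<psi>: "\<psi> \<in> hom (G\<lparr>carrier := H\<rparr>) integer_group"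
      "\<And>j f. j \<in> J \<Longrightarrow> f \<in> carrier G \<Longrightarrow> \<psi> (edge_element j f) = (if s j f = rep f then 0 else 1)"
      by (rule kurosh_extension[OF group_integer_group, of "\<lambda>_ _ _. 0" "\<lambda>j f. if s j f = rep f then 0 else 1"])
        (auto simp: hom_def s_right rep_right)
    ultimately have "\<psi> ?g = 1" using j f by simp
    moreover have gH: "?g \<in> H" using j f by (rule edge_element_mem)
    ultimately have "inj_on \<psi> (generate (G\<lparr>carrier := H\<rparr>) {?g})"
      using group.inj_on_generate_of_degree_one[OF subgroup_imp_group[OF H] \<psi>(1)] by simp
    then have "inj_on \<psi> ?A" using generate_restrict[OF H, of "{?g}"] gH A_eq by simp
    moreover have "\<psi> \<in> hom (G\<lparr>carrier := ?A\<rparr>) integer_group"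
      using hom_restrict_carrier[OF \<psi>(1), of ?A] A(2) by simp
    ultimately show ?thesis by blast
  qed
  then obtain \<delta> where "\<delta> \<in> hom (G\<lparr>carrier := ?A\<rparr>) integer_group" "inj_on \<delta> ?A" by blast
  then show ?thesis
    using group.free_group_of_rank_one[OF subgroup_imp_group[OF A(1)]] nt by simp
qed

section \<open>Factorizations and atomicity\<close>

context group
begin

lemma fst_copies: "fst ` {(H, k). k < count \<H> H} = set_mset \<H>"
  by (force simp flip: count_greater_zero_iff)

lemma factorization_indexed:
  "factorization G \<H> \<longleftrightarrow> internal_free_product G {(H, k). k < count \<H> H} fst"
proof -
  have "(\<lambda>(H, k :: nat). G\<lparr>carrier := H\<rparr>) = (\<lambda>i. G\<lparr>carrier := fst i\<rparr>)" by (auto simp: fun_eq_iff)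
  moreover have "(\<forall>H\<in>#\<H>. subgroup H G) \<longleftrightarrow> (\<forall>i\<in>{(H, k). k < count \<H> H}. subgroup (fst i) G)"
    by (simp only: ball_simps(9) flip: fst_copies)
  ultimately show ?thesis by (simp only: factorization_def internal_free_product_def)
qed

text \<open>Two copies of a nontrivial subgroup never form a free product inside \<open>G\<close>, so that multisets of
nontrivial factors are sets.\<close>

lemma factorization_iff:
  assumes nt: "\<And>H. H \<in># \<H> \<Longrightarrow> H \<noteq> {\<one>}"
  shows "factorization G \<H> \<longleftrightarrow> (\<forall>H. count \<H> H \<le> 1) \<and> internal_free_product G (set_mset \<H>) (\<lambda>H. H)"
    (is "_ \<longleftrightarrow> ?R")
proof -
  let ?I = "{(H, k). k < count \<H> H}"
  have img: "fst ` ?I = set_mset \<H>" by (rule fst_copies)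
  have nt': "fst i \<noteq> {\<one>}" if "i \<in> ?I" for i using nt img that by blast
  show ?thesis unfolding factorization_indexed
  proof
    assume fp: "internal_free_product G ?I fst"
    have inj: "inj_on fst ?I" using fp nt' by (rule internal_free_product_inj_on)
    have "count \<H> H \<le> 1" for H
    proof (rule ccontr)
      assume "\<not> count \<H> H \<le> 1"
      then have "0 < count \<H> H" "1 < count \<H> H" by linarith+
      then have "(H, 0) \<in> ?I" "(H, 1) \<in> ?I" by blast+
      then show False using inj_onD[OF inj, of "(H, 0)" "(H, 1)"] by simp
    qed
    then show ?R using internal_free_product_image[OF fp nt'] img by simp
  next
    assume R: ?R
    have "k = 0" if "(H, k) \<in> ?I" for H k
    proof -
      have "k < count \<H> H" "count \<H> H \<le> 1" using that R by auto
      then show ?thesis by linarith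
    qed
    then have "inj_on fst ?I" by (auto simp: inj_on_def)
    then have "bij_betw fst ?I (set_mset \<H>)" using img by (simp add: bij_betw_def)
    then show "internal_free_product G ?I fst" using R internal_free_product_reindex by blast
  qed
qed

lemma internal_free_product_self: "internal_free_product G {carrier G} (\<lambda>H. H)"
proof (rule internal_free_productI)
  show "subgroup H G" if "H \<in> {carrier G}" for H using that subgroup_self by simp
  show "carrier G \<subseteq> generate G (\<Union>H\<in>{carrier G}. H)" by (auto intro: generate.incl)
  fix \<phi> assume "\<And>H. H \<in> {carrier G} \<Longrightarrow>
    \<phi> H \<in> hom (G\<lparr>carrier := H\<rparr>) (free_product {carrier G} (\<lambda>H. G\<lparr>carrier := H\<rparr>))"
  then have "\<phi> (carrier G) \<in> hom G (free_product {carrier G} (\<lambda>H. G\<lparr>carrier := H\<rparr>))"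
    by (simp add: hom_def)
  then show "\<exists>\<psi>\<in>hom G (free_product {carrier G} (\<lambda>H. G\<lparr>carrier := H\<rparr>)).
      \<forall>H\<in>{carrier G}. \<forall>x\<in>H. \<psi> x = \<phi> H x" by blast
qed

lemma allocating_factors:
  assumes "allocating G R \<H>"
  shows "internal_free_product G (set_mset \<H>) (\<lambda>H. H)" "\<And>H. count \<H> H \<le> 1"
    "\<And>H. H \<in># \<H> \<Longrightarrow> H \<noteq> {\<one>}" "\<And>H. H \<in># \<H> \<Longrightarrow> subgroup H G"
    "\<And>r. r \<in> R \<Longrightarrow> \<exists>H\<in>#\<H>. r \<in> marks G H"
proof -
  have fac: "factorization G \<H>" and nt: "\<forall>H\<in>#\<H>. H \<noteq> {\<one>}"
    and R: "R \<subseteq> (\<Union>H\<in>set_mset \<H>. marks G H)"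
    using assms unfolding allocating_def by blast+
  show nt': "H \<noteq> {\<one>}" if "H \<in># \<H>" for H using nt that by blast
  have "(\<forall>H. count \<H> H \<le> 1) \<and> internal_free_product G (set_mset \<H>) (\<lambda>H. H)"
    using factorization_iff[THEN iffD1, OF nt' fac] .
  then show "internal_free_product G (set_mset \<H>) (\<lambda>H. H)" "count \<H> H \<le> 1" for H
    by blast+
  show "subgroup H G" if "H \<in># \<H>" for H using fac that unfolding factorization_def by blast
  show "\<exists>H\<in>#\<H>. r \<in> marks G H" if "r \<in> R" for r using R that by blast
qed

lemma atomic_allocating: "atomic G R \<H> \<Longrightarrow> allocating G R \<H>"
  by (simp add: atomic_def)

text \<open>Replacing \<open>H\<close> by \<open>A\<close> and \<open>B\<close> is a proper refinement that still allocates every mark.\<close>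

lemma atomic_not_split:
  assumes at: "atomic G R \<H>" and H: "H \<in># \<H>"
    and fp: "internal_free_product (G\<lparr>carrier := H\<rparr>) UNIV (\<lambda>b. if b then A else B)"
    and nt: "A \<noteq> {\<one>}" "B \<noteq> {\<one>}"
    and marks: "\<And>r. r \<in> R \<Longrightarrow> r \<in> marks G H \<Longrightarrow> r \<in> marks G A \<union> marks G B"
  shows False
proof -
  note al = allocating_factors[OF atomic_allocating[OF at]]
  have sH: "subgroup H G" using al(4) H by blast
  let ?H = "G\<lparr>carrier := H\<rparr>"
  interpret H: group ?H by (rule subgroup_imp_group[OF sH])
  have nt': "(if b then A else B) \<noteq> {\<one>\<^bsub>?H\<^esub>}" for b using nt by (cases b) simp_all
  have "inj_on (\<lambda>b. if b then A else B) UNIV" using fp nt' by (rule H.internal_free_product_inj_on)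
  then have AB: "A \<noteq> B" using inj_onD[of "\<lambda>b. if b then A else B" UNIV True False] by auto
  have fpAB: "internal_free_product ?H {A, B} (\<lambda>Z. Z)"
    using H.internal_free_product_image[OF fp nt'] by (simp add: UNIV_bool insert_commute)
  define M where "M = \<H> - {#H#}"
  have \<H>: "\<H> = add_mset H M" using H by (simp add: M_def)
  have HM: "H \<notin># M" using al(2)[of H] \<H> by (simp flip: count_greater_zero_iff)
  \<comment> \<open>The refinement as an indexed family: H is replaced by its two parts and other factors by themselves.\<close>
  define J where "J K = (if K = H then {A, B} else {K})" for K
  have fpJ: "internal_free_product (G\<lparr>carrier := K\<rparr>) (J K) (\<lambda>Z. Z)" if "K \<in># \<H>" for K
    using fpAB group.internal_free_product_self[OF subgroup_imp_group[OF al(4)[OF that]]]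
    by (simp add: J_def)
  have fpS: "internal_free_product G (Sigma (set_mset \<H>) J) (\<lambda>(K, Z). Z)"
    using al(1) fpJ by (rule internal_free_product_flatten)
  have ntS: "(case x of (K, Z) \<Rightarrow> Z) \<noteq> {\<one>}" if xS: "x \<in> Sigma (set_mset \<H>) J" for x
  proof -
    obtain K Z where x: "x = (K, Z)" "K \<in># \<H>" "Z \<in> J K" using xS by blast
    then have "Z \<in> {A, B} \<or> Z = K" by (auto simp: J_def split: if_splits)
    then show ?thesis using x(1) nt al(3)[OF x(2)] by auto
  qed
  have inj: "inj_on (\<lambda>(K, Z). Z) (Sigma (set_mset \<H>) J)"
    using fpS ntS by (rule internal_free_product_inj_on)
  have notM: "Z \<notin># M" if "Z \<in> {A, B}" for Z
  proof
    assume Z: "Z \<in># M"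
    then have "(H, Z) \<in> Sigma (set_mset \<H>) J" "(Z, Z) \<in> Sigma (set_mset \<H>) J"
      using that HM by (auto simp: \<H> J_def)
    then show False using inj_onD[OF inj, of "(H, Z)" "(Z, Z)"] Z HM by auto
  qed
  define \<K> where "\<K> = add_mset A (add_mset B M)"
  have ntK: "Z \<noteq> {\<one>}" if "Z \<in># \<K>" for Z using that nt al(3) \<H> by (auto simp: \<K>_def)
  have "(\<lambda>(K, Z). Z) ` Sigma (set_mset \<H>) J = set_mset \<K>"
    using HM by (force simp: \<H> J_def \<K>_def image_iff split: if_splits)
  then have "internal_free_product G (set_mset \<K>) (\<lambda>Z. Z)"
    using internal_free_product_image[OF fpS ntS] by simp
  moreover have "count \<K> Z \<le> 1" for Z
    using al(2)[of Z] notM AB by (auto simp: \<K>_def \<H> not_in_iff split: if_splits)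
  ultimately have fac: "factorization G \<K>" using factorization_iff ntK by blast
  have "R \<subseteq> (\<Union>Z\<in>set_mset \<K>. marks G Z)"
  proof
    fix r assume r: "r \<in> R"
    then obtain K where "K \<in># \<H>" "r \<in> marks G K" using al(5) by blast
    then show "r \<in> (\<Union>Z\<in>set_mset \<K>. marks G Z)" using marks r by (auto simp: \<K>_def \<H>)
  qed
  then have alK: "allocating G R \<K>" using fac ntK by (simp add: allocating_def)
  let ?Q = "\<lambda>H D. factorization (G\<lparr>carrier := H\<rparr>) D \<and> (\<forall>K\<in>#D. K \<noteq> {\<one>})"
  have "factorization ?H {#A, B#}"
  proof (rule H.factorization_iff[THEN iffD2])
    show "Z \<noteq> {\<one>\<^bsub>?H\<^esub>}" if "Z \<in># {#A, B#}" for Z using that nt by auto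
    have "count {#A, B#} Z \<le> 1" for Z using AB by auto
    then show "(\<forall>Z. count {#A, B#} Z \<le> 1) \<and> internal_free_product ?H (set_mset {#A, B#}) (\<lambda>Z. Z)"
      using fpAB by simp
  qed
  then have "?Q H {#A, B#}" using nt by simp
  moreover have "rel_mset ?Q M (image_mset (\<lambda>K. {#K#}) M)"
  proof -
    have "?Q K {#K#}" if "K \<in># M" for K
    proof -
      have K: "K \<in># \<H>" using that \<H> by simp
      interpret K: group "G\<lparr>carrier := K\<rparr>" by (rule subgroup_imp_group[OF al(4)[OF K]])
      show ?thesis using K.factorization_iff[of "{#K#}"] K.internal_free_product_self al(3)[OF K] by simp
    qed
    then show ?thesis
    proof (induction M)
      case (add K M)
      then show ?case using rel_mset_Plus[of ?Q K "{#K#}" M "image_mset (\<lambda>K. {#K#}) M"] by simp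
    qed (simp add: rel_mset_Zero)
  qed
  ultimately have "rel_mset ?Q \<H> (add_mset {#A, B#} (image_mset (\<lambda>K. {#K#}) M))"
    unfolding \<H> using rel_mset_Plus[of ?Q H "{#A, B#}" M "image_mset (\<lambda>K. {#K#}) M"] by blast
  moreover have "\<Sum>\<^sub># (image_mset (\<lambda>K. {#K#}) N) = N" for N :: "'a set multiset"
    by (induction N) simp_all
  then have "\<K> = \<Sum>\<^sub># (add_mset {#A, B#} (image_mset (\<lambda>K. {#K#}) M))"
    by (simp add: \<K>_def)
  ultimately have "refinement G \<H> \<K>" unfolding refinement_def by blast
  moreover have "\<K> \<noteq> \<H>" by (metis \<H> \<K>_def size_add_mset n_not_Suc_n)
  ultimately show False using at alK by (auto simp: atomic_def)
qed

text \<open>The case used below is the decomposition of \<open>H\<close> from the subgroup theorem: by atomicity it has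
just one nontrivial factor.\<close>

lemma atomic_indecomposable:
  assumes at: "atomic G R \<H>" and H: "H \<in># \<H>"
    and fp: "internal_free_product (G\<lparr>carrier := H\<rparr>) I A"
    and marks: "\<And>r. r \<in> R \<Longrightarrow> r \<in> marks G H \<Longrightarrow> \<exists>i\<in>I. r \<in> marks G (A i)"
    and i: "i \<in> I" and nt: "A i \<noteq> {\<one>}"
  shows "A i = H"
proof -
  let ?H = "G\<lparr>carrier := H\<rparr>"
  have "subgroup H G" using allocating_factors(4)[OF atomic_allocating[OF at] H] .
  then interpret H: group ?H by (rule subgroup_imp_group)
  let ?B = "generate ?H (\<Union>k\<in>I - {i}. A k)"
  have split: "internal_free_product ?H UNIV (\<lambda>b. if b then A i else ?B)"
    using fp i by (rule H.internal_free_product_split)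
  have "r \<in> marks G (A i) \<union> marks G ?B" if r: "r \<in> R" "r \<in> marks G H" for r
  proof -
    obtain k where k: "k \<in> I" "r \<in> marks G (A k)" using marks r by blast
    have "A k \<subseteq> ?B" if "k \<noteq> i" using k(1) that by (auto intro: generate.incl)
    then show ?thesis using k(2) by (cases "k = i") (auto simp: marks_def)
  qed
  then have "?B = {\<one>}" using atomic_not_split[OF at H split nt] by blast
  then have "generate ?H (\<Union>b. if b then A i else {\<one>}) = H"
    using H.internal_free_product_generate[OF split] by simp
  moreover have Ai: "subgroup (A i) ?H" using fp i by (rule H.internal_free_product_subgroup)
  then have "(\<Union>b. if b then A i else {\<one>}) \<subseteq> A i"
    using subgroup.one_closed[OF Ai] by (auto split: if_splits)
  then have "generate ?H (\<Union>b. if b then A i else {\<one>}) \<subseteq> A i"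
    using Ai by (rule H.generate_subgroup_incl)
  ultimately show ?thesis using subgroup.subset[OF Ai] by auto
qed

section \<open>Marks and conjugacy\<close>

lemma conj_class_conj:
  assumes f: "f \<in> carrier G" and g: "g \<in> carrier G"
  shows "conj_class G (f \<otimes> g \<otimes> inv f) = conj_class G g"
proof -
  have "x \<otimes> (f \<otimes> g \<otimes> inv f) \<otimes> inv x = (x \<otimes> f) \<otimes> g \<otimes> inv (x \<otimes> f)" if "x \<in> carrier G" for x
    using f g that by (simp add: m_assoc inv_mult_group)
  then have "conj_class G (f \<otimes> g \<otimes> inv f) \<subseteq> conj_class G g"
    using f unfolding conj_class_def by (smt (verit) Collect_mono m_closed)
  moreover have "x \<otimes> g \<otimes> inv x = (x \<otimes> inv f) \<otimes> (f \<otimes> g \<otimes> inv f) \<otimes> inv (x \<otimes> inv f)" if "x \<in> carrier G" for x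
    using f g that by (simp add: m_assoc inv_mult_group)
  then have "conj_class G g \<subseteq> conj_class G (f \<otimes> g \<otimes> inv f)"
    using f unfolding conj_class_def by (smt (verit) Collect_mono m_closed inv_closed)
  ultimately show ?thesis by blast
qed

lemma conj_class_self: "g \<in> carrier G \<Longrightarrow> g \<in> conj_class G g"
  unfolding conj_class_def by (auto intro!: exI[of _ \<one>])

lemma marks_common:
  assumes "r \<in> marks G H" "r \<in> marks G K" and H: "H \<subseteq> carrier G"
  obtains (Element) h where "r = Element h" "h \<in> H" "h \<in> K"
  | (Class) k f where "r = Class (conj_class G (f \<otimes> k \<otimes> inv f))" "k \<in> K" "f \<in> carrier G" "f \<otimes> k \<otimes> inv f \<in> H"
proof -
  consider h where "r = Element h" "h \<in> H" "h \<in> K"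
    | h k where "r = Class (conj_class G h)" "h \<in> H" "k \<in> K" "conj_class G h = conj_class G k"
    using assms(1,2) by (auto simp: marks_def)
  then show ?thesis
  proof cases
    case 1
    then show ?thesis by (rule that(1))
  next
    case (2 h k)
    then have "h \<in> conj_class G k" using conj_class_self H by blast
    then obtain f where "f \<in> carrier G" "h = f \<otimes> k \<otimes> inv f" by (auto simp: conj_class_def)
    then show ?thesis using that(2) 2 by blast
  qed
qed

lemma marks_nontrivial:
  assumes "R \<subseteq> marks G (carrier G - {\<one>})" "r \<in> R" "r \<in> marks G H"
  shows "H \<noteq> {\<one>}"
proof
  assume H: "H = {\<one>}"
  have "r \<in> marks G (carrier G - {\<one>})" using assms by blast
  moreover have "r \<in> marks G {\<one>}" using assms(3) H by simp
  ultimately show False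
  proof (rule marks_common)
    fix k f assume "k \<in> {\<one>}" "f \<in> carrier G" "f \<otimes> k \<otimes> inv f \<in> carrier G - {\<one>}"
    then show False by simp
  qed auto
qed

lemma conj_set: "f <# H #> inv f = {f \<otimes> h \<otimes> inv f | h. h \<in> H}"
  by (auto simp: l_coset_def r_coset_def)

lemma conj_orbit_eq:
  assumes H: "H \<subseteq> carrier G" and K: "K \<subseteq> carrier G" and g: "g \<in> carrier G"
    and fwd: "\<And>h. h \<in> H \<Longrightarrow> g \<otimes> h \<otimes> inv g \<in> K"
    and bwd: "\<And>k. k \<in> K \<Longrightarrow> inv g \<otimes> k \<otimes> g \<in> H"
  shows "conj_orbit G H = conj_orbit G K"
proof -
  have incl: "conj_orbit G A \<subseteq> conj_orbit G B"
    if A: "A \<subseteq> carrier G" and B: "B \<subseteq> carrier G" and g: "g \<in> carrier G"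
    and fwd: "\<And>h. h \<in> A \<Longrightarrow> g \<otimes> h \<otimes> inv g \<in> B"
    and bwd: "\<And>k. k \<in> B \<Longrightarrow> inv g \<otimes> k \<otimes> g \<in> A" for A B g
  proof
    fix Z assume "Z \<in> conj_orbit G A"
    then obtain f where f: "f \<in> carrier G" "Z = {f \<otimes> h \<otimes> inv f | h. h \<in> A}"
      by (auto simp: conj_orbit_def conj_set)
    let ?f = "f \<otimes> inv g"
    have "f \<otimes> h \<otimes> inv f = ?f \<otimes> (g \<otimes> h \<otimes> inv g) \<otimes> inv ?f" if "h \<in> A" for h
      using that A g f(1) by (simp add: m_assoc inv_mult_group subset_iff)
    moreover have "?f \<otimes> k \<otimes> inv ?f = f \<otimes> (inv g \<otimes> k \<otimes> g) \<otimes> inv f" if "k \<in> B" for k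
      using that B g f(1) by (simp add: m_assoc inv_mult_group subset_iff)
    ultimately have "Z = {?f \<otimes> k \<otimes> inv ?f | k. k \<in> B}"
      unfolding f(2) using fwd bwd by (intro equalityI subsetI) (clarify, blast)+
    then show "Z \<in> conj_orbit G B" using f(1) g by (auto simp: conj_orbit_def conj_set)
  qed
  have "conj_orbit G K \<subseteq> conj_orbit G H"
    by (rule incl[OF K H, of "inv g"]) (use g fwd bwd in auto)
  then show ?thesis using incl[OF H K g fwd bwd] by blast
qed

text \<open>If \<open>H\<close> and \<open>K\<close> are conjugate into each other, then \<open>y H y\<inverse> \<subseteq> H\<close> for \<open>y = f g\<close>, and equality has to
be shown, which can fail for subgroups in general. Here the retraction onto the free factor \<open>H\<close>
sends \<open>y\<close> to some \<open>\<rho> y \<in> H\<close> and fixes \<open>H\<close>, so conjugation by \<open>y\<close> agrees on \<open>H\<close> with conjugation by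
\<open>\<rho> y\<close> and is therefore onto.\<close>

lemma conj_mutual:
  assumes fp: "internal_free_product G I (\<lambda>H. H)" and H: "H \<in> I" and K: "K \<subseteq> carrier G"
    and g: "g \<in> carrier G" "\<And>h. h \<in> H \<Longrightarrow> g \<otimes> h \<otimes> inv g \<in> K"
    and f: "f \<in> carrier G" "\<And>k. k \<in> K \<Longrightarrow> f \<otimes> k \<otimes> inv f \<in> H"
  shows "conj_orbit G H = conj_orbit G K"
proof -
  obtain \<rho> where \<rho>: "\<rho> \<in> hom G G" "\<And>x. x \<in> H \<Longrightarrow> \<rho> x = x" "\<And>x. x \<in> carrier G \<Longrightarrow> \<rho> x \<in> H"
    using internal_free_product_retraction[OF fp H] by metis
  interpret r: group_hom G G \<rho> using \<rho>(1) by (simp add: group_hom_def group_hom_axioms_def is_group)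
  have sH: "subgroup H G" using fp H by (rule internal_free_product_subgroup)
  have HC: "h \<in> carrier G" if "h \<in> H" for h using sH that by (rule subgroup.mem_carrier)
  have KC: "k \<in> carrier G" if "k \<in> K" for k using K that by blast
  let ?y = "f \<otimes> g"
  have y: "?y \<in> carrier G" using f g by simp
  have ry: "\<rho> ?y \<in> H" "\<rho> ?y \<in> carrier G" using \<rho>(3)[OF y] HC by auto
  have "inv g \<otimes> k \<otimes> g \<in> H" if k: "k \<in> K" for k
  proof -
    let ?h = "f \<otimes> k \<otimes> inv f"
    have h: "?h \<in> H" using f k by blast
    define h2 where "h2 = inv (\<rho> ?y) \<otimes> ?h \<otimes> \<rho> ?y"
    have h2: "h2 \<in> H" unfolding h2_def
      by (intro subgroup.m_closed[OF sH] subgroup.m_inv_closed[OF sH] h ry)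
    have h2c: "h2 \<in> carrier G" using HC h2 .
    have "?y \<otimes> h2 \<otimes> inv ?y = f \<otimes> (g \<otimes> h2 \<otimes> inv g) \<otimes> inv f"
      using f(1) g(1) h2c by (simp add: m_assoc inv_mult_group)
    then have "?y \<otimes> h2 \<otimes> inv ?y \<in> H" using f(2) g(2) h2 by simp
    then have "?y \<otimes> h2 \<otimes> inv ?y = \<rho> (?y \<otimes> h2 \<otimes> inv ?y)" using \<rho>(2) by simp
    also have "\<dots> = \<rho> ?y \<otimes> h2 \<otimes> inv (\<rho> ?y)"
      using y h2c \<rho>(2)[OF h2] r.hom_mult r.hom_inv by (metis inv_closed m_closed)
    also have "\<dots> = ?h" using ry HC[OF h] by (simp add: h2_def m_assoc)
    finally have "h2 = inv ?y \<otimes> ?h \<otimes> ?y" using y h2c by (metis inv_mult_cancel(1) inv_solve_right' m_assoc m_closed inv_closed)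
    also have "\<dots> = inv g \<otimes> k \<otimes> g"
      using f(1) g(1) KC[OF k] by (simp add: m_assoc inv_mult_group)
    finally show ?thesis using h2 by simp
  qed
  then show ?thesis using conj_orbit_eq[OF subgroup.subset[OF sH] K g(1)] g(2) by blast
qed

end

context kurosh_system
begin

text \<open>An element that lies in both \<open>H\<close> and \<open>K j\<close> belongs to the vertex group at \<open>t j 1 = 1\<close> itself, without
conjugation. This is the source of the stronger conclusion for marks that are elements.\<close>

lemma mark_in_vertex_group:
  assumes j: "j \<in> J" and r: "r \<in> marks G H" "r \<in> marks G (K j)"
  obtains f where "f \<in> carrier G" "r \<in> marks G (vertex_group j (t j f))" "\<And>g. r = Element g \<Longrightarrow> f = \<one>"
  using r subgroup.subset[OF H]
proof (cases rule: marks_common)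
  case (Element h)
  then have "h \<in> vertex_group j (t j \<one>)" using j H_closed by (simp add: t_one vertex_group_def)
  then show ?thesis using that[of \<one>] Element by (auto simp: marks_def)
next
  case (Class k f)
  obtain h' where h': "h' \<in> H" "h' \<otimes> (f \<otimes> k \<otimes> inv f) \<otimes> inv h' \<in> vertex_group j (t j (inv f))"
    using conj_mem_vertex_group[OF j Class(2-4)] by blast
  have "conj_class G (h' \<otimes> (f \<otimes> k \<otimes> inv f) \<otimes> inv h') = conj_class G (f \<otimes> k \<otimes> inv f)"
    using h'(1) Class(4) H_closed by (intro conj_class_conj) auto
  then have "r \<in> marks G (vertex_group j (t j (inv f)))" using h'(2) Class(1) by (auto simp: marks_def)
  then show ?thesis using that[of "inv f"] Class by simp
qed

lemma vertex_group_in_index: "j \<in> J \<Longrightarrow> f \<in> carrier G \<Longrightarrow> Inl (j, t j f) \<in> kurosh_index"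
  by (auto simp: kurosh_index_def)

end

context group
begin

text \<open>Decompose \<open>H\<close> by the subgroup theorem with respect to the factorization \<open>\<K>\<close>. Every mark of \<open>H\<close> is
allocated to some factor of \<open>\<K>\<close> and hence lies in some vertex group, so the decomposition respects
the marks. The vertex group containing \<open>r\<close> is nontrivial and by atomicity equals \<open>H\<close>.\<close>

lemma atomic_factor_conj_into:
  assumes R: "R \<subseteq> marks G (carrier G - {\<one>})"
    and at: "atomic G R \<H>" and al: "allocating G R \<K>"
    and HH: "H \<in># \<H>" and KK: "K \<in># \<K>" and r: "r \<in> allocated G R H" "r \<in> allocated G R K"
  obtains f where "f \<in> carrier G" "\<And>h. h \<in> H \<Longrightarrow> f \<otimes> h \<otimes> inv f \<in> K" "\<And>g. r = Element g \<Longrightarrow> f = \<one>"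
proof -
  have sH: "subgroup H G" using allocating_factors(4)[OF atomic_allocating[OF at] HH] .
  obtain rep s t len where sys: "kurosh_system G (set_mset \<K>) (\<lambda>K. K) H rep s t len"
    using kurosh_system_exists[OF allocating_factors(1)[OF al] sH] by blast
  interpret kurosh_system G "set_mset \<K>" "\<lambda>K. K" H rep s t len by (rule sys)
  have rR: "r \<in> R" "r \<in> marks G H" "r \<in> marks G K" using r by (auto simp: allocated_def)
  obtain f where f: "f \<in> carrier G" "r \<in> marks G (vertex_group K (t K f))" "\<And>g. r = Element g \<Longrightarrow> f = \<one>"
    using mark_in_vertex_group[OF KK rR(2,3)] by blast
  have "kurosh_factor (Inl (K, t K f)) = H"
  proof (rule atomic_indecomposable[OF at HH kurosh_subgroup])
    fix r' assume r': "r' \<in> R" "r' \<in> marks G H"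
    then obtain K' where K': "K' \<in># \<K>" "r' \<in> marks G K'" using allocating_factors(5)[OF al] by blast
    then obtain f' where "f' \<in> carrier G" "r' \<in> marks G (vertex_group K' (t K' f'))"
      using mark_in_vertex_group[OF K'(1) r'(2) K'(2)] by blast
    then show "\<exists>i\<in>kurosh_index. r' \<in> marks G (kurosh_factor i)"
      using vertex_group_in_index[OF K'(1)] by (intro bexI[of _ "Inl (K', t K' f')"]) (auto simp: kurosh_factor_def)
  next
    show "Inl (K, t K f) \<in> kurosh_index" using KK f(1) by (rule vertex_group_in_index)
    show "kurosh_factor (Inl (K, t K f)) \<noteq> {\<one>}"
      using marks_nontrivial[OF R rR(1) f(2)] by (simp add: kurosh_factor_def)
  qed
  then have "vertex_group K (t K f) = H" by (simp add: kurosh_factor_def)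
  then have "\<And>h. h \<in> H \<Longrightarrow> t K f \<otimes> h \<otimes> inv (t K f) \<in> K" by (auto simp: vertex_group_def)
  then show ?thesis using that[of "t K f"] t_closed[OF KK f(1)] t_one[OF KK] f(3) by metis
qed

text \<open>Without marks, every decomposition of \<open>H\<close> respects them; take the one induced by the cyclic factors
of a basis.\<close>

lemma atomic_unmarked_rank_one:
  assumes S: "free_basis G S" and at: "atomic G R \<H>" and HH: "H \<in># \<H>" and un: "allocated G R H = {}"
  shows "free_group_of_rank (G\<lparr>carrier := H\<rparr>) 1"
proof -
  note al = allocating_factors[OF atomic_allocating[OF at]]
  have sH: "subgroup H G" using al(4) HH .
  obtain rep s t len where sys: "kurosh_system G S (\<lambda>s. generate G {s}) H rep s t len"
    using kurosh_system_exists[OF free_basis_internal_free_product[OF S] sH] by blast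
  interpret kurosh_system G S "\<lambda>s. generate G {s}" H rep s t len by (rule sys)
  interpret H': group "G\<lparr>carrier := H\<rparr>" by (rule subgroup_imp_group[OF sH])
  have "\<exists>i\<in>kurosh_index. kurosh_factor i \<noteq> {\<one>}"
  proof (rule ccontr)
    assume "\<not> ?thesis"
    then have "(\<Union>i\<in>kurosh_index. kurosh_factor i) \<subseteq> {\<one>}" by auto
    then have "generate G (\<Union>i\<in>kurosh_index. kurosh_factor i) \<subseteq> {\<one>}"
      by (rule generate_subgroup_incl) (rule triv_subgroup)
    then have "H \<subseteq> {\<one>}" using kurosh_generate by blast
    then show False using al(3)[OF HH] subgroup.one_closed[OF sH] by auto
  qed
  then obtain i where i: "i \<in> kurosh_index" "kurosh_factor i \<noteq> {\<one>}" by blast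
  have "kurosh_factor i = H"
    by (rule atomic_indecomposable[OF at HH kurosh_subgroup _ i]) (use un in \<open>auto simp: allocated_def\<close>)
  moreover have "free_group_of_rank (G\<lparr>carrier := kurosh_factor i\<rparr>) 1"
  proof (rule kurosh_factor_rank_one[OF _ i])
    fix j assume j: "j \<in> S"
    obtain \<delta> where \<delta>: "\<delta> \<in> hom G integer_group" "\<And>s. s \<in> S \<Longrightarrow> \<delta> s = 1"
      using free_basis_extend[OF S group_integer_group, of "\<lambda>_. 1"] by auto
    have "j \<in> carrier G" using S j by (auto simp: free_basis_iff)
    then show "\<exists>\<delta>\<in>hom G integer_group. inj_on \<delta> (generate G {j})"
      using inj_on_generate_of_degree_one \<delta> j by blast
  qed
  ultimately show ?thesis by simp
qed

end

section \<open>Counting the factors\<close>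

definition parity_group :: "bool monoid" where
  "parity_group = \<lparr>carrier = UNIV, monoid.mult = (\<noteq>), one = False\<rparr>"

lemma parity_group_simps [simp]:
  "carrier parity_group = UNIV" "x \<otimes>\<^bsub>parity_group\<^esub> y \<longleftrightarrow> x \<noteq> y" "\<one>\<^bsub>parity_group\<^esub> = False"
  by (simp_all add: parity_group_def)

lemma group_parity_group: "group parity_group"
  by (rule groupI) auto

lemma hom_parity_inv:
  assumes "group F" "\<chi> \<in> hom F parity_group" "x \<in> carrier F"
  shows "\<chi> (inv\<^bsub>F\<^esub> x) = \<chi> x"
proof -
  interpret group F by (rule assms(1))
  have "\<chi> (inv\<^bsub>F\<^esub> x \<otimes>\<^bsub>F\<^esub> x) = (\<chi> (inv\<^bsub>F\<^esub> x) \<noteq> \<chi> x)"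
    using hom_mult[OF assms(2), of "inv\<^bsub>F\<^esub> x" x] assms(3) by simp
  moreover have "\<chi> \<one>\<^bsub>F\<^esub> = False" using hom_one[OF assms(2,1) group_parity_group] by simp
  ultimately show ?thesis using l_inv[OF assms(3)] by simp
qed

text \<open>Extensional functions, so that homomorphisms are determined by their values on the group and can
be counted.\<close>

definition parity_homs :: "('a, 'b) monoid_scheme \<Rightarrow> 'a set set \<Rightarrow> ('a \<Rightarrow> bool) set" where
  "parity_homs F M = {\<chi> \<in> hom F parity_group \<inter> extensional (carrier F). \<forall>H\<in>M. \<forall>x\<in>H. \<not> \<chi> x}"

context group
begin

lemma free_group_of_rank_one_parity:
  assumes "free_group_of_rank G 1"
  obtains a \<chi> where "a \<in> carrier G" "generate G {a} = carrier G" "\<chi> \<in> hom G parity_group" "\<chi> a"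
proof -
  obtain S where S: "card S = 1" "free_basis G S" using assms by (auto simp: free_group_of_rank_def)
  then obtain a where a: "S = {a}" by (auto simp: card_1_singleton_iff)
  obtain \<chi> where "\<chi> \<in> hom G parity_group" "\<And>s. s \<in> S \<Longrightarrow> \<chi> s = True"
    using free_basis_extend[OF S(2) group_parity_group, of "\<lambda>_. True"] by auto
  moreover have "a \<in> carrier G" using S(2) a by (simp add: free_basis_iff)
  ultimately show ?thesis using that free_basis_generate[OF S(2)] a by blast
qed

text \<open>A homomorphism to the group of order two that vanishes on the factors in \<open>M\<close> is a free choice of one
of two values on a generator of each other factor.\<close>

lemma card_parity_homs:
  assumes fp: "internal_free_product G I (\<lambda>H. H)" and fin: "finite I" and M: "M \<subseteq> I"
    and one: "\<And>H. H \<in> I - M \<Longrightarrow> free_group_of_rank (G\<lparr>carrier := H\<rparr>) 1"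
  shows "card (parity_homs G M) = 2 ^ card (I - M)"
proof -
  have sub: "subgroup H G" if "H \<in> I" for H using fp that by (rule internal_free_product_subgroup)
  have "\<exists>a \<chi>. a \<in> H \<and> generate G {a} = H \<and> \<chi> \<in> hom (G\<lparr>carrier := H\<rparr>) parity_group \<and> \<chi> a"
    if H: "H \<in> I - M" for H
  proof -
    have sH: "subgroup H G" using sub H by blast
    obtain a \<chi> where "a \<in> H" "generate (G\<lparr>carrier := H\<rparr>) {a} = H"
      "\<chi> \<in> hom (G\<lparr>carrier := H\<rparr>) parity_group" "\<chi> a"
      using group.free_group_of_rank_one_parity[OF subgroup_imp_group[OF sH] one[OF H]] by auto
    then show ?thesis using generate_restrict[OF sH, of "{a}"] by auto
  qed
  then obtain a \<chi> where a: "\<And>H. H \<in> I - M \<Longrightarrow> a H \<in> H" "\<And>H. H \<in> I - M \<Longrightarrow> generate G {a H} = H"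
    and \<chi>: "\<And>H. H \<in> I - M \<Longrightarrow> \<chi> H \<in> hom (G\<lparr>carrier := H\<rparr>) parity_group" "\<And>H. H \<in> I - M \<Longrightarrow> \<chi> H (a H)"
    by metis
  let ?supp = "\<lambda>\<xi>. {H \<in> I - M. \<xi> (a H)}"
  have "bij_betw ?supp (parity_homs G M) (Pow (I - M))"
  proof (rule bij_betwI')
    fix \<xi> \<zeta> assume \<xi>: "\<xi> \<in> parity_homs G M" and \<zeta>: "\<zeta> \<in> parity_homs G M"
    show "(?supp \<xi> = ?supp \<zeta>) = (\<xi> = \<zeta>)"
    proof
      assume eq: "?supp \<xi> = ?supp \<zeta>"
      have homs: "\<xi> \<in> hom G parity_group" "\<zeta> \<in> hom G parity_group" using \<xi> \<zeta> by (auto simp: parity_homs_def)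
      have "\<xi> x = \<zeta> x" if H: "H \<in> I" and x: "x \<in> H" for H x
      proof (cases "H \<in> M")
        case True
        then show ?thesis using \<xi> \<zeta> x by (simp add: parity_homs_def)
      next
        case False
        then have HI: "H \<in> I - M" using H by blast
        then have aH: "\<xi> (a H) = \<zeta> (a H)" using eq by blast
        show ?thesis
          by (rule hom_eq_on_generate[OF is_group group_parity_group homs, of "{a H}"])
            (use a[OF HI] x aH subgroup.mem_carrier[OF sub[OF H]] in auto)
      qed
      then have "\<xi> x = \<zeta> x" if "x \<in> carrier G" for x
        using internal_free_product_hom_eq[OF fp group_parity_group homs] that by blast
      moreover have "\<xi> \<in> extensional (carrier G)" "\<zeta> \<in> extensional (carrier G)"
        using \<xi> \<zeta> by (auto simp: parity_homs_def)
      ultimately show "\<xi> = \<zeta>" by (intro extensionalityI)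
    qed simp
  next
    fix U assume "U \<in> Pow (I - M)"
    then have U: "U \<subseteq> I - M" by simp
    let ?\<phi> = "\<lambda>H. if H \<in> U then \<chi> H else (\<lambda>_. False)"
    have "?\<phi> H \<in> hom (G\<lparr>carrier := H\<rparr>) parity_group" if "H \<in> I" for H
      using \<chi>(1)[of H] U by (auto simp: hom_def)
    then obtain \<psi> where \<psi>: "\<psi> \<in> hom G parity_group" "\<And>H x. H \<in> I \<Longrightarrow> x \<in> H \<Longrightarrow> \<psi> x = ?\<phi> H x"
      using internal_free_product_extend[OF fp group_parity_group, of ?\<phi>] by blast
    let ?\<xi> = "restrict \<psi> (carrier G)"
    have val: "?\<xi> x = ?\<phi> H x" if "H \<in> I" "x \<in> H" for H x
      using that \<psi>(2)[OF that] subgroup.mem_carrier[OF sub] by simp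
    have "?\<xi> \<in> hom G parity_group" using \<psi>(1) by (auto simp: hom_def)
    moreover have "\<not> ?\<xi> x" if "H \<in> M" "x \<in> H" for H x
    proof -
      have "H \<in> I" "H \<notin> U" using that(1) M U by blast+
      then show ?thesis using val[of H x] that(2) by simp
    qed
    ultimately have "?\<xi> \<in> parity_homs G M" by (auto simp: parity_homs_def)
    moreover have "?supp ?\<xi> = U"
    proof -
      have "?\<xi> (a H) \<longleftrightarrow> H \<in> U" if "H \<in> I - M" for H
        using val[of H "a H"] a(1)[OF that] \<chi>(2)[OF that] that by auto
      then show ?thesis using U by blast
    qed
    ultimately show "\<exists>\<xi>\<in>parity_homs G M. U = ?supp \<xi>" by blast
  qed auto
  then have "card (parity_homs G M) = card (Pow (I - M))" by (rule bij_betw_same_card)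
  then show ?thesis using fin by (simp add: card_Pow)
qed

section \<open>Comparing two atomic factorizations\<close>

definition marked :: "'a mark set \<Rightarrow> 'a set multiset \<Rightarrow> 'a set set" where
  "marked R \<H> = {H \<in> set_mset \<H>. allocated G R H \<noteq> {}}"

lemma induced_partition_marked: "induced_partition G R \<H> = allocated G R ` marked R \<H>"
  by (auto simp: induced_partition_def marked_def)

context
  fixes R
  assumes R: "R \<subseteq> marks G (carrier G - {\<one>})"
begin

lemma atomic_conj_orbit_eq:
  assumes at: "atomic G R \<H>" "atomic G R \<K>" and H: "H \<in># \<H>" and K: "K \<in># \<K>"
    and r: "r \<in> allocated G R H" "r \<in> allocated G R K"
  shows "conj_orbit G H = conj_orbit G K" "r = Element g \<Longrightarrow> H = K"
proof -
  note al = atomic_allocating[OF at(1)] atomic_allocating[OF at(2)]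
  obtain f where f: "f \<in> carrier G" "\<And>h. h \<in> H \<Longrightarrow> f \<otimes> h \<otimes> inv f \<in> K" "\<And>g. r = Element g \<Longrightarrow> f = \<one>"
    using atomic_factor_conj_into[OF R at(1) al(2) H K r] by blast
  obtain f' where f': "f' \<in> carrier G" "\<And>h. h \<in> K \<Longrightarrow> f' \<otimes> h \<otimes> inv f' \<in> H" "\<And>g. r = Element g \<Longrightarrow> f' = \<one>"
    using atomic_factor_conj_into[OF R at(2) al(1) K H r(2,1)] by blast
  have sub: "H \<subseteq> carrier G" "K \<subseteq> carrier G"
    using allocating_factors(4)[OF al(1) H] allocating_factors(4)[OF al(2) K] by (simp_all add: subgroup.subset)
  show "conj_orbit G H = conj_orbit G K"
    using conj_mutual[OF allocating_factors(1)[OF al(1)] H sub(2) f(1,2) f'(1,2)] .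
  assume "r = Element g"
  then have "f = \<one>" "f' = \<one>" using f(3) f'(3) by auto
  then have "h \<in> K" if "h \<in> H" for h using f(2)[OF that] sub that by auto
  moreover have "k \<in> H" if "k \<in> K" for k using f'(2)[OF that] \<open>f' = \<one>\<close> sub that by auto
  ultimately show "H = K" by blast
qed

text \<open>Otherwise a nontrivial element of \<open>H\<close> would be conjugate into two different factors of \<open>\<K>\<close>.\<close>

lemma atomic_factor_unique:
  assumes at: "atomic G R \<H>" and al: "allocating G R \<K>" and H: "H \<in># \<H>"
    and K: "K \<in># \<K>" "K' \<in># \<K>" and r: "r \<in> allocated G R H" "r \<in> allocated G R K"
    and r': "r' \<in> allocated G R H" "r' \<in> allocated G R K'"
  shows "K = K'"
proof (rule ccontr)
  assume ne: "K \<noteq> K'"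
  have sH: "subgroup H G" and nt: "H \<noteq> {\<one>}"
    using allocating_factors(3,4)[OF atomic_allocating[OF at]] H by auto
  then obtain h where h: "h \<in> H" "h \<noteq> \<one>" using subgroup.one_closed[OF sH] by blast
  have hc: "h \<in> carrier G" using sH h(1) by (rule subgroup.mem_carrier)
  obtain f where f: "f \<in> carrier G" "f \<otimes> h \<otimes> inv f \<in> K"
    using atomic_factor_conj_into[OF R at al H K(1) r] h(1) by metis
  obtain f' where f': "f' \<in> carrier G" "f' \<otimes> h \<otimes> inv f' \<in> K'"
    using atomic_factor_conj_into[OF R at al H K(2) r'] h(1) by metis
  have "f \<otimes> h \<otimes> inv f = (f \<otimes> inv f') \<otimes> (f' \<otimes> h \<otimes> inv f') \<otimes> inv (f \<otimes> inv f')"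
    using f(1) f'(1) hc by (simp add: m_assoc inv_mult_group)
  then have "f \<otimes> h \<otimes> inv f = \<one>"
    using internal_free_product_conj_disjoint[OF allocating_factors(1)[OF al] K ne f(2) f'(2)] f(1) f'(1) by simp
  then have "h = \<one>" using f(1) hc by (metis inv_closed inv_mult_cancel(1) inv_unique' l_inv m_assoc m_closed r_one)
  then show False using h(2) by simp
qed

lemma atomic_allocated_eq:
  assumes at: "atomic G R \<H>" "atomic G R \<K>" and H: "H \<in># \<H>" and K: "K \<in># \<K>"
    and r: "r \<in> allocated G R H" "r \<in> allocated G R K"
  shows "allocated G R H = allocated G R K"
proof -
  have incl: "allocated G R H \<subseteq> allocated G R K"
    if at: "atomic G R \<H>" "atomic G R \<K>" and H: "H \<in># \<H>" and K: "K \<in># \<K>"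
      and r: "r \<in> allocated G R H" "r \<in> allocated G R K" for \<H> \<K> H K
  proof
    fix r' assume r': "r' \<in> allocated G R H"
    note al = atomic_allocating[OF at(2)]
    obtain K' where K': "K' \<in># \<K>" "r' \<in> allocated G R K'"
      using allocating_factors(5)[OF al, of r'] r' by (auto simp: allocated_def)
    then show "r' \<in> allocated G R K" using atomic_factor_unique[OF at(1) al H K K'(1) r r' K'(2)] by simp
  qed
  show ?thesis using incl[OF at H K r] incl[OF at(2,1) K H r(2,1)] by blast
qed

lemma marked_partner:
  assumes al: "allocating G R \<K>" and H: "H \<in> marked R \<H>"
  obtains r K where "r \<in> allocated G R H" "K \<in># \<K>" "r \<in> allocated G R K" "K \<in> marked R \<K>"
proof -
  obtain r where r: "r \<in> allocated G R H" using H by (auto simp: marked_def)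
  then obtain K where "K \<in># \<K>" "r \<in> allocated G R K"
    using allocating_factors(5)[OF al, of r] by (auto simp: allocated_def)
  then show ?thesis using that r by (auto simp: marked_def)
qed

lemma atomic_induced_partition_eq:
  assumes "atomic G R \<H>" "atomic G R \<K>"
  shows "induced_partition G R \<H> = induced_partition G R \<K>"
proof -
  have "induced_partition G R \<H> \<subseteq> induced_partition G R \<K>"
    if at: "atomic G R \<H>" "atomic G R \<K>" for \<H> \<K>
    unfolding induced_partition_marked
  proof clarify
    fix H assume H: "H \<in> marked R \<H>"
    obtain r K where K: "r \<in> allocated G R H" "K \<in># \<K>" "r \<in> allocated G R K" "K \<in> marked R \<K>"
      using marked_partner[OF atomic_allocating[OF at(2)] H] .
    have "H \<in># \<H>" using H by (simp add: marked_def)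
    then show "allocated G R H \<in> allocated G R ` marked R \<K>"
      using atomic_allocated_eq[OF at _ K(2,1,3)] K(4) by blast
  qed
  then show ?thesis using assms by blast
qed

lemma inj_on_allocated:
  assumes at: "atomic G R \<H>" shows "inj_on (allocated G R) (marked R \<H>)"
proof (rule inj_onI)
  fix H K assume "H \<in> marked R \<H>" "K \<in> marked R \<H>" and eq: "allocated G R H = allocated G R K"
  then obtain r where "H \<in># \<H>" "K \<in># \<H>" "r \<in> allocated G R H" "r \<in> allocated G R K"
    by (auto simp: marked_def)
  then show "H = K" using atomic_factor_unique[OF at atomic_allocating[OF at]] by blast
qed

text \<open>Vanishing on a subgroup is invariant under conjugation, and the marked factors of \<open>\<H>\<close> and \<open>\<K>\<close> are
conjugate into each other.\<close>

lemma parity_homs_marked_eq: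
  assumes "atomic G R \<H>" "atomic G R \<K>"
  shows "parity_homs G (marked R \<H>) = parity_homs G (marked R \<K>)"
proof -
  have "parity_homs G (marked R \<H>) \<subseteq> parity_homs G (marked R \<K>)"
    if at: "atomic G R \<H>" "atomic G R \<K>" for \<H> \<K>
  proof
    fix \<chi> assume \<chi>: "\<chi> \<in> parity_homs G (marked R \<H>)"
    then have hom: "\<chi> \<in> hom G parity_group" by (simp add: parity_homs_def)
    have "\<not> \<chi> x" if K: "K \<in> marked R \<K>" and x: "x \<in> K" for K x
    proof -
      note al = atomic_allocating[OF at(1)]
      obtain r H where H: "r \<in> allocated G R K" "H \<in># \<H>" "r \<in> allocated G R H" "H \<in> marked R \<H>"
        using marked_partner[OF al K] .
      have K\<K>: "K \<in># \<K>" using K by (simp add: marked_def)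
      obtain f where f: "f \<in> carrier G" "f \<otimes> x \<otimes> inv f \<in> H"
        using atomic_factor_conj_into[OF R at(2) al K\<K> H(2,1,3)] x by metis
      have xc: "x \<in> carrier G"
        using allocating_factors(4)[OF atomic_allocating[OF at(2)] K\<K>] x by (rule subgroup.mem_carrier)
      have "\<chi> (f \<otimes> x \<otimes> inv f) = ((\<chi> f \<noteq> \<chi> x) \<noteq> \<chi> (inv f))"
        using hom f(1) xc by (simp add: hom_def)
      also have "\<dots> = \<chi> x" using hom_parity_inv[OF is_group hom f(1)] by auto
      finally show ?thesis using \<chi> f(2) H(4) by (auto simp: parity_homs_def)
    qed
    then show "\<chi> \<in> parity_homs G (marked R \<K>)" using \<chi> by (auto simp: parity_homs_def)
  qed
  then show ?thesis using assms by blast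
qed

text \<open>The marked factors correspond to the blocks of the partition, and the number \<open>m\<close> of unmarked ones
is determined by a count of homomorphisms. Both ingredients depend only on data that atomic
factorizations share.\<close>

lemma atomic_size:
  assumes S: "free_basis G S" and at: "atomic G R \<H>"
  shows "\<exists>m. size \<H> = card (induced_partition G R \<H>) + m \<and> card (parity_homs G (marked R \<H>)) = 2 ^ m"
proof -
  note al = allocating_factors[OF atomic_allocating[OF at]]
  let ?M = "marked R \<H>" and ?I = "set_mset \<H>"
  have M: "?M \<subseteq> ?I" by (auto simp: marked_def)
  have "\<H> = mset_set ?I"
  proof (rule multiset_eqI)
    fix H show "count \<H> H = count (mset_set ?I) H"
      using al(2)[of H] by (cases "H \<in># \<H>") (auto simp: not_in_iff simp flip: count_greater_zero_iff intro: antisym)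
  qed
  then have "size \<H> = card ?I" by (metis size_mset_set)
  also have "\<dots> = card ?M + card (?I - ?M)"
    using M by (metis card_Diff_subset card_mono finite_set_mset finite_subset le_add_diff_inverse)
  also have "card ?M = card (induced_partition G R \<H>)"
    unfolding induced_partition_marked using inj_on_allocated[OF at] by (simp add: card_image)
  finally have "size \<H> = card (induced_partition G R \<H>) + card (?I - ?M)" .
  moreover have "card (parity_homs G ?M) = 2 ^ card (?I - ?M)"
    by (rule card_parity_homs[OF al(1) finite_set_mset M])
      (use atomic_unmarked_rank_one[OF S at] in \<open>auto simp: marked_def\<close>)
  ultimately show ?thesis by blast
qed

end

end

theorem proposition3p2:
  fixes F :: "('a, 'b) monoid_scheme" and n :: nat and R :: "'a mark set"
  assumes "free_group_of_rank F n"
    and "finite R"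
    and "R \<subseteq> marks F (carrier F - {\<one>\<^bsub>F\<^esub>})"
  shows "(\<forall>\<H> \<K>. atomic F R \<H> \<and> atomic F R \<K> \<longrightarrow> size \<H> = size \<K>)
    \<and> (\<forall>\<H> \<K>. atomic F R \<H> \<and> atomic F R \<K> \<longrightarrow>
           induced_partition F R \<H> = induced_partition F R \<K>)
    \<and> (\<forall>r \<in> R. \<forall>\<H> \<K>. atomic F R \<H> \<and> atomic F R \<K> \<longrightarrow>
           (\<forall>H \<in># \<H>. \<forall>K \<in># \<K>. r \<in> allocated F R H \<and> r \<in> allocated F R K \<longrightarrow>
              conj_orbit F H = conj_orbit F K \<and> (\<forall>g. r = Element g \<longrightarrow> H = K)))
    \<and> (\<forall>\<H>. atomic F R \<H> \<longrightarrow>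
           (\<forall>H \<in># \<H>. allocated F R H = {} \<longrightarrow> free_group_of_rank (F\<lparr>carrier := H\<rparr>) 1))"
proof -
  obtain S where F: "group F" and S: "free_basis F S"
    using assms(1) by (auto simp: free_group_of_rank_def)
  interpret F: group F by (rule F)
  note R = assms(3)
  have size_eq: "size \<H> = size \<K>" if at: "atomic F R \<H>" "atomic F R \<K>" for \<H> \<K>
  proof -
    obtain m where m: "size \<H> = card (induced_partition F R \<H>) + m"
      "card (parity_homs F (F.marked R \<H>)) = 2 ^ m" using F.atomic_size[OF R S at(1)] by blast
    obtain m' where m': "size \<K> = card (induced_partition F R \<K>) + m'"
      "card (parity_homs F (F.marked R \<K>)) = 2 ^ m'" using F.atomic_size[OF R S at(2)] by blast
    have "(2::nat) ^ m = 2 ^ m'" using m(2) m'(2) F.parity_homs_marked_eq[OF R at] by simp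
    then have "m = m'" by simp
    then show ?thesis using m(1) m'(1) F.atomic_induced_partition_eq[OF R at] by simp
  qed
  show ?thesis
  proof (intro conjI allI ballI impI; (elim conjE)?)
    fix \<H> \<K> assume at: "atomic F R \<H>" "atomic F R \<K>"
    show "size \<H> = size \<K>" using at by (rule size_eq)
    show "induced_partition F R \<H> = induced_partition F R \<K>"
      using at by (rule F.atomic_induced_partition_eq[OF R])
    fix r H K assume h: "H \<in># \<H>" "K \<in># \<K>" "r \<in> allocated F R H" "r \<in> allocated F R K"
    show "conj_orbit F H = conj_orbit F K" using at h by (rule F.atomic_conj_orbit_eq(1)[OF R])
    show "H = K" if "r = Element g" for g using at h that by (rule F.atomic_conj_orbit_eq(2)[OF R])
  next
    fix \<H> H assume "atomic F R \<H>" "H \<in># \<H>" "allocated F R H = {}"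
    then show "free_group_of_rank (F\<lparr>carrier := H\<rparr>) 1" by (rule F.atomic_unmarked_rank_one[OF S])
  qed
qed

end
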